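(* Let $P\in\mathbb{Z}[x,y,z]$ be inhomogeneous. Then $P$ admits a complete Rado functional if and only if, after a suitable permutation of the variables, there are $r,a\in\mathbb{N}$, $\rho\in\mathbb{Q}$ and a homogeneous $H\in\mathbb{Z}[x,y]$ such that $P(x,y,z)=z^{r-a\rho}H(xz^\rho,y)$ (as an identity of functions of positive reals $x,y,z$). In this case, writing $H(x,y)=\prod_{i=1}^{k}(a_ix-b_iy)$ for the factorization of $H$ into linear factors over $\mathbb{C}$ (for $P$ in the permuted variables): (1) if $P$ is partition regular over $\mathbb{N}$, then there is $i\in[k]$ with $a_i\neq0$ such that $\frac{b_i}{a_i}$ is a $\rho$-power in $\mathbb{Q}$; (2) if there is $i\in[k]$ with $a_i\ne 0$ such that $\frac{b_i}{a_i}$ is a $\rho$-power in $\mathbb{N}$, then $P$ is partition regular over $\mathbb{N}$.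
   Context: $\operatorname{supp}(P)$ is the set of exponent vectors $\alpha\in\mathbb{N}_0^3$ of monomials of $P$ with nonzero coefficient; $P$ is homogeneous if all these have the same total degree. For $\vec t\in\mathbb{N}^3$, $\alpha\cdot\vec t=\sum_j\alpha(j)t_j$; $\vec t$ is $c$-monochromatic if all its entries have the same color. A complete Rado functional for $P$ is a tuple $(J_0,\dots,J_l,d_0,\dots,d_{l-1})$, with $J_0,\dots,J_l$ a partition of $\operatorname{supp}(P)$ into nonempty sets and $d_i\in\mathbb{N}$, such that for every finite coloring $c$ of $\mathbb{N}$ there are infinitely many $c$-monochromatic $\vec t\in\mathbb{N}^3$ for which there exist integers $M_0>\dots>M_l$ with $J_i=\{\alpha\in\operatorname{supp}(P):\alpha\cdot\vec t=M_i\}$ and $M_i-M_l=d_i$ for $i<l$. $P$ is partition regular over $\mathbb{N}$ if for every finite coloring of $\mathbb{N}$ there are monochromatic $x,y,z\in\mathbb{N}$ with $P(x,y,z)=0$. A nonzero complex number $w$ is a $\rho$-power in $\mathbb{Q}$ if $w=q^\rho$ for some positive rational $q$, and a $\rho$-power in $\mathbb{N}$ if $w=l^\rho$ for some $l\in\mathbb{N}$ (positive real powers). *)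

theory Defs
  imports "HOL-Analysis.Analysis" "HOL-Library.Poly_Mapping"
begin

(* Polynomials in variables indexed by the finite type 'n are finitely supported maps from
   exponent vectors to coefficients; the support of P is Poly_Mapping.keys P. *)

type_synonym ('n, 'a) mpoly = "(nat ^ 'n) \<Rightarrow>\<^sub>0 'a"

definition homogeneous :: "('n::finite, 'a::zero) mpoly \<Rightarrow> bool" where
  "homogeneous P \<longleftrightarrow>
     (\<forall>\<alpha>\<in>Poly_Mapping.keys P. \<forall>\<beta>\<in>Poly_Mapping.keys P.
        (\<Sum>j\<in>UNIV. \<alpha> $ j) = (\<Sum>j\<in>UNIV. \<beta> $ j))"

definition eval_mpoly :: "('n::finite, int) mpoly \<Rightarrow> 'a::comm_ring_1 ^ 'n \<Rightarrow> 'a" where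
  "eval_mpoly P x =
     (\<Sum>\<alpha>\<in>Poly_Mapping.keys P.
        of_int (Poly_Mapping.lookup P \<alpha>) * (\<Prod>j\<in>UNIV. (x $ j) ^ (\<alpha> $ j)))"

(* Renames the j-th variable to the (\<sigma> j)-th. Only meaningful for bijective \<sigma>, since
   map_key presupposes injectivity. *)
definition permute_vars :: "('n::finite \<Rightarrow> 'n) \<Rightarrow> ('n, 'a::zero) mpoly \<Rightarrow> ('n, 'a) mpoly" where
  "permute_vars \<sigma> P = Poly_Mapping.map_key (\<lambda>\<alpha>. \<chi> j. \<alpha> $ \<sigma> j) P"

(* The linear form a x - b y as a polynomial; axis i 1 is the exponent vector of the i-th variable. *)
definition linear_form :: "complex \<Rightarrow> complex \<Rightarrow> (2, complex) mpoly" where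
  "linear_form a b = Poly_Mapping.single (axis 1 1) a - Poly_Mapping.single (axis 2 1) b"

(* Throughout, the set N of the mathematics is the set of positive naturals {0<..}; values of a
   colouring at 0 are irrelevant. *)

definition finite_colouring :: "(nat \<Rightarrow> nat) \<Rightarrow> bool" where
  "finite_colouring c \<longleftrightarrow> finite (c ` {0<..})"

definition monochromatic :: "(nat \<Rightarrow> nat) \<Rightarrow> nat ^ 'n \<Rightarrow> bool" where
  "monochromatic c t \<longleftrightarrow> (\<forall>j. t $ j > 0) \<and> (\<forall>i j. c (t $ i) = c (t $ j))"

definition dotp :: "nat ^ 'n::finite \<Rightarrow> nat ^ 'n \<Rightarrow> nat" where
  "dotp \<alpha> t = (\<Sum>j\<in>UNIV. \<alpha> $ j * t $ j)"

(* The tuple (J_0, ..., J_l, d_0, ..., d_(l-1)) is given by l and the values J i for i \<le> l and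
   d i for i < l; other values of J and d are irrelevant. *)
definition complete_rado_functional ::
  "(3, int) mpoly \<Rightarrow> nat \<Rightarrow> (nat \<Rightarrow> (nat ^ 3) set) \<Rightarrow> (nat \<Rightarrow> nat) \<Rightarrow> bool" where
  "complete_rado_functional P l J d \<longleftrightarrow>
     (\<Union>i\<le>l. J i) = Poly_Mapping.keys P \<and>
     (\<forall>i\<le>l. J i \<noteq> {}) \<and>
     (\<forall>i\<le>l. \<forall>j\<le>l. i \<noteq> j \<longrightarrow> J i \<inter> J j = {}) \<and>
     (\<forall>i<l. d i > 0) \<and>
     (\<forall>c. finite_colouring c \<longrightarrow>
        infinite {t :: nat ^ 3. monochromatic c t \<and>
          (\<exists>M :: nat \<Rightarrow> int.
             (\<forall>i j. i < j \<and> j \<le> l \<longrightarrow> M i > M j) \<and>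
             (\<forall>i\<le>l. J i = {\<alpha> \<in> Poly_Mapping.keys P. int (dotp \<alpha> t) = M i}) \<and>
             (\<forall>i<l. M i - M l = int (d i)))})"

definition admits_complete_rado_functional :: "(3, int) mpoly \<Rightarrow> bool" where
  "admits_complete_rado_functional P \<longleftrightarrow> (\<exists>l J d. complete_rado_functional P l J d)"

definition partition_regular :: "(3, int) mpoly \<Rightarrow> bool" where
  "partition_regular P \<longleftrightarrow>
     (\<forall>c. finite_colouring c \<longrightarrow>
        (\<exists>t :: nat ^ 3. monochromatic c t \<and> eval_mpoly P (\<chi> j. int (t $ j)) = 0))"

definition rho_power_in_Q :: "rat \<Rightarrow> complex \<Rightarrow> bool" where
  "rho_power_in_Q \<rho> w \<longleftrightarrow>
     (\<exists>q :: rat. q > 0 \<and> w = complex_of_real (real_of_rat q powr real_of_rat \<rho>))"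

definition rho_power_in_N :: "rat \<Rightarrow> complex \<Rightarrow> bool" where
  "rho_power_in_N \<rho> w \<longleftrightarrow>
     (\<exists>l :: nat. l > 0 \<and> w = complex_of_real (real l powr real_of_rat \<rho>))"

(* P(x,y,z) = z^(r - a \<rho>) H(x z^\<rho>, y) for positive reals, where x, y, z are the variables with
   index 1, 2, 3. *)
definition rado_form ::
  "(3, int) mpoly \<Rightarrow> nat \<Rightarrow> nat \<Rightarrow> rat \<Rightarrow> (2, int) mpoly \<Rightarrow> bool" where
  "rado_form P r a \<rho> H \<longleftrightarrow>
     r > 0 \<and> a > 0 \<and> homogeneous H \<and>
     (\<forall>x y z :: real. x > 0 \<and> y > 0 \<and> z > 0 \<longrightarrow>
        eval_mpoly P (vector [x, y, z]) =
          z powr (real r - real a * real_of_rat \<rho>) *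
          eval_mpoly H (vector [x * z powr real_of_rat \<rho>, y]))"

end

theory Submission
  imports Defs "HOL-Computational_Algebra.Nth_Powers"
begin

text \<open>
  A Rado functional forces every \<open>(\<alpha> - \<beta>) \<bullet> t\<close> with \<open>\<alpha>, \<beta> \<in> supp P\<close>, and hence every integer
  combination \<open>u \<bullet> t\<close> of such forms, to take a constant value on infinitely many monochromatic
  \<open>t\<close>. Colouring by \<open>\<lfloor>log g n\<rfloor> mod K\<close> shows that some nonempty subset of the nonzero entries of
  \<open>u\<close> then sums to zero. As \<open>P\<close> is inhomogeneous, this puts the support on a line of
  direction \<open>(1, -1, \<rho>)\<close>, up to a permutation of the variables. Conversely, on such a line
  all \<open>\<alpha> \<bullet> t\<close> coincide as soon as \<open>y = x + \<rho> z\<close>, an equation that is partition regular by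
  Brauer's theorem; this gives a functional with a single block.

  For the equation \<open>P = 0\<close>, i.e. \<open>x z\<^sup>\<rho> / y = b\<^sub>i / a\<^sub>i\<close> for some \<open>i\<close>, a value \<open>l\<^sup>\<rho>\<close> is attained at
  \<open>(l 2\<^sup>x, l 2\<^sup>y, l 2\<^sup>z)\<close> with \<open>y = x + \<rho> z\<close>, and a value that is not a \<open>\<rho>\<close>-power is excluded by
  colouring with a \<open>p\<close>-adic valuation modulo the numerator of \<open>\<rho>\<close>.
\<close>

section \<open>Brauer's theorem for two parameters\<close>

text \<open>Pigeonhole on the \<open>K\<close> translates of \<open>C\<^sup>n\<close> by multiples of \<open>(m, 2 m, \<dots>, n m)\<close> inside
  \<open>{1..2 N}\<^sup>n\<close>; this replaces van der Waerden's theorem in the usual proof of Brauer's theorem.\<close>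

lemma common_differences:
  fixes C :: "nat set"
  assumes C: "C \<subseteq> {1..N}" "N \<le> r * card C" and N: "N > 0" "m * n * K \<le> N" and K: "(2 * r) ^ n < K"
  obtains d where "d \<in> {1..K}" "\<And>j. j \<in> {1..n} \<Longrightarrow> \<exists>v\<in>C. v + m * j * d \<in> C"
proof -
  define D where "D = {1..K} \<times> ({1..n} \<rightarrow>\<^sub>E C)"
  define E where "E = ({1..n} \<rightarrow>\<^sub>E {1..2 * N})"
  define g where "g = (\<lambda>(s, f). \<lambda>j\<in>{1..n}. f j + m * j * s)"
  have finC: "finite C" using C(1) finite_subset by blast
  have cardC: "card C > 0" using C(2) N(1) by (cases "card C") auto
  have "g ` D \<subseteq> E"
  proof (clarsimp simp: D_def E_def g_def, intro conjI)
    fix s f j assume *: "Suc 0 \<le> s" "s \<le> K" "f \<in> {Suc 0..n} \<rightarrow>\<^sub>E C" "Suc 0 \<le> j" "j \<le> n"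
    have "f j \<in> C" using * by (auto simp: PiE_iff)
    then have f: "1 \<le> f j" "f j \<le> N" using C(1) by auto
    have "m * j * s \<le> m * n * K" using * by (intro mult_mono) auto
    then show "f j + m * j * s \<le> 2 * N" using f N(2) by linarith
    show "Suc 0 \<le> f j + m * j * s" using f by simp
  qed
  moreover have "finite E" unfolding E_def by (intro finite_PiE) auto
  ultimately have "card (g ` D) \<le> card E" by (rule card_mono[rotated])
  also have "card E = (2 * N) ^ n" by (simp add: E_def card_PiE)
  \<comment> \<open>The density \<open>1 / r\<close> of \<open>C\<close> enters here: by the choice
    of \<open>K\<close> there are more pairs of a shift and a tuple than points of
    \<open>E\<close>.\<close>
  also have "\<dots> \<le> (2 * r * card C) ^ n" using C(2) by (intro power_mono) auto
  also have "\<dots> = (2 * r) ^ n * card C ^ n" by (simp add: power_mult_distrib)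
  also have "\<dots> < K * card C ^ n" using K cardC by simp
  also have "K * card C ^ n = card D" by (simp add: D_def card_cartesian_product card_PiE)
  finally have "\<not> inj_on g D" using card_image[of g D] by auto
  then obtain s f t h where st: "(s, f) \<in> D" "(t, h) \<in> D" "g (s, f) = g (t, h)" "(s, f) \<noteq> (t, h)"
    by (auto simp: inj_on_def)
  have eq: "f j + m * j * s = h j + m * j * t" if "j \<in> {1..n}" for j
    using fun_cong[OF st(3), of j] that by (simp add: g_def)
  have *: "\<exists>d\<in>{1..K}. \<forall>j\<in>{1..n}. \<exists>v\<in>C. v + m * j * d \<in> C"
    if "(s, f) \<in> D" "(t, h) \<in> D" "s < t" "\<And>j. j \<in> {1..n} \<Longrightarrow> f j + m * j * s = h j + m * j * t"
    for s f t h
  proof (rule bexI[of _ "t - s"], rule ballI)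
    show "t - s \<in> {1..K}" using that by (auto simp: D_def)
    fix j assume j: "j \<in> {1..n}"
    have "m * j * t = m * j * s + m * j * (t - s)"
      using that(3) by (metis add_diff_inverse_nat distrib_left less_imp_not_less)
    then have "f j = h j + m * j * (t - s)" using that(4)[OF j] by linarith
    moreover have "f j \<in> C" "h j \<in> C" using that j by (auto simp: D_def PiE_iff)
    ultimately show "\<exists>v\<in>C. v + m * j * (t - s) \<in> C" by metis
  qed
  \<comment> \<open>Equal shifts would force equal tuples. So the collision joins different shifts,
    and their distance serves as \<open>d\<close> for all \<open>j\<close> at once.\<close>
  have "s \<noteq> t"
  proof
    assume "s = t"
    then have "f j = h j" if "j \<in> {1..n}" for j using eq[OF that] by simp
    moreover have "f \<in> {1..n} \<rightarrow>\<^sub>E C" "h \<in> {1..n} \<rightarrow>\<^sub>E C" using st(1,2) by (auto simp: D_def)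
    ultimately have "f = h" by (intro PiE_ext)
    then show False using st \<open>s = t\<close> by simp
  qed
  then consider "s < t" | "t < s" by linarith
  then have "\<exists>d\<in>{1..K}. \<forall>j\<in>{1..n}. \<exists>v\<in>C. v + m * j * d \<in> C"
  proof cases
    case 1
    show ?thesis by (rule *[OF st(1,2) 1 eq])
  next
    case 2
    show ?thesis by (rule *[OF st(2,1) 2 eq[symmetric]])
  qed
  then show thesis using that by blast
qed

text \<open>Averaging: at most \<open>r\<close> classes, each with fewer than \<open>N / r\<close>
  elements, cannot cover the interval.\<close>

lemma large_colour_class:
  fixes c :: "nat \<Rightarrow> 'a"
  assumes "card (c ` {1..N}) \<le> r" "N > 0"
  obtains y where "N \<le> r * card {i \<in> {1..N}. c i = y}"
proof (rule ccontr)
  assume "\<not> thesis"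
  then have less: "r * card {i \<in> {1..N}. c i = y} < N" for y
    using that by (meson not_le)
  have "{1..N} = (\<Union>y\<in>c ` {1..N}. {i \<in> {1..N}. c i = y})" by auto
  then have "N = card (\<Union>y\<in>c ` {1..N}. {i \<in> {1..N}. c i = y})"
    by (metis card_atLeastAtMost diff_Suc_1)
  also have "\<dots> \<le> (\<Sum>y\<in>c ` {1..N}. card {i \<in> {1..N}. c i = y})"
    by (rule card_UN_le) simp
  finally have "N \<le> (\<Sum>y\<in>c ` {1..N}. card {i \<in> {1..N}. c i = y})" .
  then have "r * N \<le> (\<Sum>y\<in>c ` {1..N}. r * card {i \<in> {1..N}. c i = y})"
    by (simp flip: sum_distrib_left)
  also have "\<dots> < (\<Sum>y\<in>c ` {1..N}. N)"
    using less assms(2) by (intro sum_strict_mono) auto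
  also have "\<dots> \<le> r * N" using assms(1) by simp
  finally show False by simp
qed

text \<open>If the colour of a large class also occurs at some \<open>k d j\<close>, we are done; otherwise
  \<open>k d {1..n}\<close> misses that colour, and the induction hypothesis applies to its dilate.\<close>

lemma brauer_finite:
  assumes k: "k > (0::nat)"
  shows "\<exists>N>0. \<forall>c :: nat \<Rightarrow> 'a. card (c ` {1..N}) \<le> r \<longrightarrow>
    (\<exists>x w. x > 0 \<and> w > 0 \<and> x + m * w \<le> N \<and> k * w \<le> N \<and> c (x + m * w) = c x \<and> c (k * w) = c x)"
proof (induction r)
  case 0
  then show ?case by (intro exI[of _ 1]) auto
next
  case (Suc r)
  then obtain n where n: "n > 0" and IH: "\<And>c :: nat \<Rightarrow> 'a. card (c ` {1..n}) \<le> r \<Longrightarrow>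
    (\<exists>x w. x > 0 \<and> w > 0 \<and> x + m * w \<le> n \<and> k * w \<le> n \<and> c (x + m * w) = c x \<and> c (k * w) = c x)"
    by blast
  \<comment> \<open>\<open>K\<close> just exceeds the pigeonhole bound for density
    \<open>1 / Suc r\<close>, \<open>N\<close> bounds the shifts \<open>m * j * s\<close>, and
    \<open>N'\<close> leaves room for \<open>k * d * j\<close> with \<open>d \<le> K\<close> and
    \<open>j \<le> n\<close>.\<close>
  define K where "K = Suc ((2 * Suc r) ^ n)"
  define N where "N = Suc (m * n * K)"
  define N' where "N' = N + k * n * K"
  show ?case
  proof (rule exI[of _ N'], intro conjI allI impI)
    show "N' > 0" by (simp add: N'_def N_def)
    fix c :: "nat \<Rightarrow> 'a" assume card: "card (c ` {1..N'}) \<le> Suc r"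
    have "card (c ` {1..N}) \<le> card (c ` {1..N'})"
      by (intro card_mono image_mono) (auto simp: N'_def)
    with card have "card (c ` {1..N}) \<le> Suc r" by simp
    then obtain y where y: "N \<le> Suc r * card {i \<in> {1..N}. c i = y}"
      by (rule large_colour_class) (auto simp: N_def)
    define C where "C = {i \<in> {1..N}. c i = y}"
    obtain d where d: "d \<in> {1..K}" "\<And>j. j \<in> {1..n} \<Longrightarrow> \<exists>v\<in>C. v + m * j * d \<in> C"
    proof (rule common_differences[of C N "Suc r" m n K])
      show "N \<le> Suc r * card C" using y by (simp add: C_def)
    qed (auto simp: C_def N_def K_def)
    have kd: "k * d * i \<in> {1..N'}" if "i \<in> {1..n}" for i
    proof -
      have "k * d * i \<le> k * K * n" using d that by (intro mult_mono) auto
      also have "\<dots> = k * n * K" by simp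
      finally have "k * d * i \<le> N'" unfolding N'_def by linarith
      then show ?thesis using d that k by simp
    qed
    show "\<exists>x w. x > 0 \<and> w > 0 \<and> x + m * w \<le> N' \<and> k * w \<le> N' \<and> c (x + m * w) = c x \<and> c (k * w) = c x"
    proof (cases "\<exists>j\<in>{1..n}. c (k * d * j) = y")
      case True
      then obtain j where j: "j \<in> {1..n}" "c (k * d * j) = y" by blast
      then obtain v where "v \<in> C" "v + m * j * d \<in> C" using d by blast
      \<comment> \<open>With \<open>x = v\<close> and \<open>w = d * j\<close>, the numbers
        \<open>x\<close>, \<open>x + m * w\<close> and \<open>k * w\<close> all have colour
        \<open>y\<close>.\<close>
      then show ?thesis using j d kd[of j]
        by (intro exI[of _ v] exI[of _ "d * j"]) (auto simp: C_def mult_ac N'_def)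
    next
      case False
      define c' where "c' = (\<lambda>i. c (k * d * i))"
      have "c' ` {1..n} \<subseteq> c ` {1..N'} - {y}" using False kd by (auto simp: c'_def)
      \<comment> \<open>The colour \<open>y\<close> must really occur for its removal to lower the
        bound from \<open>Suc r\<close> to \<open>r\<close>.\<close>
      moreover have "y \<in> c ` {1..N'}"
      proof -
        have "N \<le> Suc r * card C" using y by (simp only: C_def)
        then have "C \<noteq> {}" by (auto simp: N_def)
        then show ?thesis by (auto simp: C_def N'_def)
      qed
      ultimately have "card (c' ` {1..n}) \<le> r"
        using card card_mono[of "c ` {1..N'} - {y}" "c' ` {1..n}"] by simp
      then obtain x w where xw: "x > 0" "w > 0" "x + m * w \<le> n" "k * w \<le> n"
        "c' (x + m * w) = c' x" "c' (k * w) = c' x"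
        using IH by blast
      \<comment> \<open>The pattern \<open>x\<close>, \<open>x + m * w\<close>, \<open>k * w\<close>
        is invariant under dilation, here by \<open>k * d\<close>.\<close>
      have "c (k * d * x + m * (k * d * w)) = c (k * d * x)" "c (k * (k * d * w)) = c (k * d * x)"
        using xw by (simp_all add: c'_def algebra_simps)
      moreover have "k * d * x + m * (k * d * w) \<le> N'" "k * (k * d * w) \<le> N'"
        using kd[of "x + m * w"] kd[of "k * w"] xw k by (auto simp: algebra_simps)
      ultimately show ?thesis using xw d k
        by (intro exI[of _ "k * d * x"] exI[of _ "k * d * w"]) auto
    qed
  qed
qed

lemma brauer:
  fixes c :: "nat \<Rightarrow> 'a"
  assumes "k > 0" "finite (c ` {0<..})"
  obtains x w where "x > 0" "w > 0" "c (x + m * w) = c x" "c (k * w) = c x"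
proof -
  obtain N where N: "\<And>c' :: nat \<Rightarrow> 'a. card (c' ` {1..N}) \<le> card (c ` {0<..}) \<Longrightarrow>
    (\<exists>x w. x > 0 \<and> w > 0 \<and> x + m * w \<le> N \<and> k * w \<le> N \<and> c' (x + m * w) = c' x \<and> c' (k * w) = c' x)"
    using brauer_finite[OF assms(1)] by blast
  have "card (c ` {1..N}) \<le> card (c ` {0<..})" using assms(2) by (intro card_mono) auto
  then show thesis using N[of c] that by blast
qed

section \<open>Linear forms with nonzero subset sums\<close>

text \<open>For two numbers of one colour, the floors of the logarithms to base \<open>g\<close>
  agree, so that the ratio is below \<open>g = 1 / (1 - \<epsilon>)\<close>, or differ by at least
  \<open>K\<close>, so that the ratio exceeds \<open>1 / \<epsilon>\<close>.\<close>

lemma close_or_far_colouring: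
  fixes \<epsilon> :: real
  assumes "0 < \<epsilon>" "\<epsilon> < 1"
  obtains c :: "nat \<Rightarrow> nat" where "finite (range c)"
    "\<And>x y. \<lbrakk>0 < x; x \<le> y; c x = c y\<rbrakk> \<Longrightarrow> (1 - \<epsilon>) * y \<le> x \<or> x \<le> \<epsilon> * y"
proof -
  define g where "g = 1 / (1 - \<epsilon>)"
  have g: "g > 1" using assms by (simp add: g_def)
  obtain n where n: "1 / \<epsilon> < g ^ n" using real_arch_pow[OF g] by blast
  \<comment> \<open>One more than \<open>n\<close>: floors at distance \<open>K\<close> only
    guarantee logarithms more than \<open>K - 1\<close> apart.\<close>
  define K where "K = Suc n"
  define c where "c = (\<lambda>x::nat. nat \<lfloor>log g x\<rfloor> mod K)"
  show thesis
  proof (rule that)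
    have "range c \<subseteq> {..<K}" by (auto simp: c_def K_def)
    then show "finite (range c)" by (rule finite_subset) simp
    fix x y :: nat assume xy: "0 < x" "x \<le> y" "c x = c y"
    have log_mult_pow: "log g (x * g ^ i) = log g x + i" for i
      using g xy by (simp add: log_mult log_nat_power)
    have le: "log g x \<le> log g y" using g xy by simp
    define a b where ab: "a = nat \<lfloor>log g x\<rfloor>" "b = nat \<lfloor>log g y\<rfloor>"
    have "log g x \<ge> 0" using g xy by simp
    then have a: "a \<le> log g x" "log g x < a + 1" and b: "b \<le> log g y" "log g y < b + 1"
      using le unfolding ab by linarith+
    have "a \<le> b" using le by (simp add: ab floor_mono nat_mono)
    have "b mod K = a mod K" using xy(3) by (simp add: c_def ab)
    then have "K dvd b - a" using \<open>a \<le> b\<close> by (simp add: mod_eq_dvd_iff_nat)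
    then have "b - a = 0 \<or> K \<le> b - a" by (auto dest: dvd_imp_le)
    then consider "a = b" | "a + K \<le> b"
      using \<open>a \<le> b\<close> by linarith
    then show "(1 - \<epsilon>) * y \<le> x \<or> x \<le> \<epsilon> * y"
    proof cases
      case 1
      then have "log g y < log g (x * g ^ 1)" unfolding log_mult_pow using a b by simp
      then have "y < x * g" using g xy by simp
      then show ?thesis using assms by (simp add: g_def field_simps)
    next
      case 2
      then have "real a + K \<le> b" by linarith
      then have "log g (x * g ^ n) < log g y" unfolding log_mult_pow using a b by (simp add: K_def)
      then have "x * g ^ n < y" using g xy by simp
      then have "x * g ^ n \<le> y" by simp
      moreover have "x * (1 / \<epsilon>) \<le> x * g ^ n" using n by (intro mult_left_mono) auto
      ultimately have "x * (1 / \<epsilon>) \<le> y" by linarith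
      then show ?thesis using assms by (simp add: field_simps)
    qed
  qed
qed

text \<open>Refining \<open>c\<close> by giving each number up to \<open>B\<close> a colour of its
  own makes every monochromatic vector with a small entry constant, which leaves only finitely many
  in \<open>S\<close>.\<close>

lemma finite_monochromatic_if_bounded:
  fixes B :: nat and S :: "(nat ^ 'n::finite) set"
  assumes c: "finite_colouring c" and S: "\<And>t. \<lbrakk>t \<in> S; monochromatic c t\<rbrakk> \<Longrightarrow> \<exists>i. t $ i \<le> B"
  shows "\<exists>c'. finite_colouring c' \<and> finite {t :: nat ^ 'n. monochromatic c' t \<and> t \<in> S}"
proof -
  define c' where "c' = (\<lambda>n. if n \<le> B then n else Suc B + c n)"
  have "c' ` {0<..} \<subseteq> {..B} \<union> (\<lambda>n. Suc B + n) ` (c ` {0<..})" by (auto simp: c'_def)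
  moreover have "finite ({..B} \<union> (\<lambda>n. Suc B + n) ` (c ` {0<..}))"
    using c by (simp add: finite_colouring_def)
  ultimately have fc: "finite_colouring c'"
    unfolding finite_colouring_def by (rule finite_subset)
  have "{t. monochromatic c' t \<and> t \<in> S} \<subseteq> (\<lambda>x. \<chi> i. x) ` {..B}"
  proof clarify
    fix t assume t: "monochromatic c' t" "t \<in> S"
    have *: "c (t $ i) = c (t $ j) \<and> (t $ i \<le> B \<longleftrightarrow> t $ j \<le> B) \<and> (t $ i \<le> B \<longrightarrow> t $ i = t $ j)" for i j
    proof -
      have "c' (t $ i) = c' (t $ j)" using t(1) by (auto simp: monochromatic_def)
      then show ?thesis by (auto simp: c'_def split: if_splits)
    qed
    then have "monochromatic c t" using t(1) by (auto simp: monochromatic_def)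
    then obtain i where "t $ i \<le> B" using S t(2) by blast
    then have "t $ j = t $ i" for j using *[of i j] by simp
    then have "t = (\<chi> j. t $ i)" by (metis vec_eq_iff vec_lambda_beta)
    with \<open>t $ i \<le> B\<close> show "t \<in> (\<lambda>x. \<chi> i. x) ` {..B}" by blast
  qed
  then have "finite {t. monochromatic c' t \<and> t \<in> S}"
    by (rule finite_subset) simp
  with fc show ?thesis by blast
qed

text \<open>The necessity half of Rado's theorem, for a fixed right-hand side. Let \<open>x\<close>
  be the largest entry with nonzero coefficient. The other such entries are nearly \<open>x\<close>
  or negligible, so the form is about \<open>x\<close> times a nonzero subset sum; this bounds
  \<open>x\<close> in terms of \<open>e\<close>.\<close>

lemma finite_monochromatic_linear_solutions:
  fixes v :: "'n::finite \<Rightarrow> int" and e :: int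
  assumes v: "v i1 \<noteq> 0" and nz: "\<And>I. \<lbrakk>I \<noteq> {}; \<forall>i\<in>I. v i \<noteq> 0\<rbrakk> \<Longrightarrow> sum v I \<noteq> 0"
  shows "\<exists>c. finite_colouring c \<and>
    finite {t :: nat ^ 'n. monochromatic c t \<and> (\<Sum>i\<in>UNIV. v i * int (t $ i)) = e}"
proof -
  define V where "V = (\<Sum>i\<in>UNIV. real_of_int \<bar>v i\<bar>)"
  have "real_of_int \<bar>v i1\<bar> \<le> V" unfolding V_def by (rule member_le_sum) auto
  moreover have "real_of_int \<bar>v i1\<bar> \<ge> 1" using v by linarith
  ultimately have V: "V \<ge> 1" by linarith
  \<comment> \<open>Chosen so that the approximation errors of all terms together are at most
    \<open>x / 2\<close>.\<close>
  define \<epsilon> where "\<epsilon> = 1 / (2 * V)"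
  have \<epsilon>: "0 < \<epsilon>" "\<epsilon> < 1" using V by (auto simp: \<epsilon>_def)
  obtain c :: "nat \<Rightarrow> nat" where c: "finite (range c)"
    "\<And>x y. \<lbrakk>0 < x; x \<le> y; c x = c y\<rbrakk> \<Longrightarrow> (1 - \<epsilon>) * y \<le> x \<or> x \<le> \<epsilon> * y"
    using close_or_far_colouring[OF \<epsilon>] by blast
  have "\<exists>c'. finite_colouring c' \<and>
    finite {t :: nat ^ 'n. monochromatic c' t \<and> t \<in> {t. (\<Sum>i\<in>UNIV. v i * int (t $ i)) = e}}"
  proof (rule finite_monochromatic_if_bounded[where c = c and B = "nat (2 * \<bar>e\<bar>)"])
    show "finite_colouring c"
      unfolding finite_colouring_def by (rule finite_subset[OF _ c(1)]) blast
    fix t :: "nat ^ 'n" assume "t \<in> {t. (\<Sum>i\<in>UNIV. v i * int (t $ i)) = e}" and mono: "monochromatic c t"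
    then have sum_e: "(\<Sum>i\<in>UNIV. v i * int (t $ i)) = e" by simp
    define x where "x = Max ((\<lambda>i. t $ i) ` {i. v i \<noteq> 0})"
    have "x \<in> (\<lambda>i. t $ i) ` {i. v i \<noteq> 0}" unfolding x_def using v by (intro Max_in) auto
    then obtain i0 where i0: "v i0 \<noteq> 0" "t $ i0 = x" by auto
    have max: "t $ i \<le> x" if "v i \<noteq> 0" for i unfolding x_def using that by (intro Max_ge) auto
    \<comment> \<open>The indices of the entries close to the maximum. By the colouring, the
      remaining entries with nonzero coefficient are at most \<open>\<epsilon> * x\<close>.\<close>
    define I where "I = {i. v i \<noteq> 0 \<and> (1 - \<epsilon>) * x \<le> t $ i}"
    have "i0 \<in> I" using i0 \<epsilon> by (auto simp: I_def algebra_simps)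
    then have "sum v I \<noteq> 0" by (intro nz) (auto simp: I_def)
    then have "1 \<le> \<bar>real_of_int (sum v I)\<bar>" by linarith
    from mult_right_mono[OF this, of x] have "x \<le> \<bar>real_of_int (sum v I) * x\<bar>"
      by (simp add: abs_mult del: of_int_sum)
    have near: "\<bar>v i * (real (t $ i) - (if i \<in> I then real x else 0))\<bar> \<le> \<bar>v i\<bar> * (\<epsilon> * x)" for i
    proof (cases "v i = 0")
      case False
      have "0 < t $ i" "c (t $ i) = c x" using mono i0 by (auto simp: monochromatic_def)
      then have "(1 - \<epsilon>) * x \<le> t $ i \<or> t $ i \<le> \<epsilon> * x" using c(2) max[OF False] by blast
      then have "\<bar>real (t $ i) - (if i \<in> I then real x else 0)\<bar> \<le> \<epsilon> * x"
        using False max[OF False] by (auto simp: I_def algebra_simps)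
      then show ?thesis by (simp add: abs_mult mult_left_mono)
    qed simp
    have "\<bar>e - real_of_int (sum v I) * x\<bar> = \<bar>\<Sum>i\<in>UNIV. v i * (real (t $ i) - (if i \<in> I then real x else 0))\<bar>"
    proof -
      have "(\<Sum>i\<in>UNIV. v i * (if i \<in> I then real x else 0)) = (\<Sum>i\<in>UNIV. if i \<in> I then v i * real x else 0)"
        by (intro sum.cong) auto
      also have "\<dots> = sum v I * x"
        by (simp add: sum.If_cases sum_distrib_right)
      finally have "(\<Sum>i\<in>UNIV. v i * (if i \<in> I then real x else 0)) = sum v I * x" .
      then show ?thesis by (simp add: right_diff_distrib sum_subtractf flip: sum_e)
    qed
    also have "\<dots> \<le> (\<Sum>i\<in>UNIV. \<bar>v i\<bar> * (\<epsilon> * x))"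
      by (rule order.trans[OF sum_abs]) (intro sum_mono near)
    also have "\<dots> = V * (\<epsilon> * x)" by (simp add: V_def sum_distrib_right)
    also have "\<dots> = x / 2" using V by (simp add: \<epsilon>_def)
    finally have "x \<le> 2 * \<bar>real_of_int e\<bar>" using \<open>x \<le> \<bar>real_of_int (sum v I) * x\<bar>\<close> by linarith
    then have "t $ i0 \<le> nat (2 * \<bar>e\<bar>)" using i0 by linarith
    then show "\<exists>i. t $ i \<le> nat (2 * \<bar>e\<bar>)" by blast
  qed
  then show ?thesis by simp
qed

section \<open>Rado functionals force a collinear support\<close>

text \<open>The levels \<open>M\<close> vary with \<open>t\<close>, but the distances between them
  are prescribed by \<open>d\<close>; only this part of a Rado functional is used below.\<close>

lemma crf_fixed_differences:
  assumes "complete_rado_functional P l J d"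
  obtains T \<delta> where
    "\<And>c. finite_colouring c \<Longrightarrow> infinite {t. monochromatic c t \<and> t \<in> T}"
    "\<And>t \<alpha> \<beta>. \<lbrakk>t \<in> T; \<alpha> \<in> Poly_Mapping.keys P; \<beta> \<in> Poly_Mapping.keys P\<rbrakk>
       \<Longrightarrow> int (dotp \<alpha> t) - int (dotp \<beta> t) = \<delta> \<alpha> - (\<delta> \<beta> :: int)"
proof -
  define T where "T = {t. \<exists>M :: nat \<Rightarrow> int.
    (\<forall>i j. i < j \<and> j \<le> l \<longrightarrow> M i > M j) \<and>
    (\<forall>i\<le>l. J i = {\<alpha> \<in> Poly_Mapping.keys P. int (dotp \<alpha> t) = M i}) \<and>
    (\<forall>i<l. M i - M l = int (d i))}"
  define idx where "idx = (\<lambda>\<alpha>. SOME i. i \<le> l \<and> \<alpha> \<in> J i)"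
  \<comment> \<open>The height of the block of \<open>\<alpha>\<close> above the last block, hence 0
    on the last block itself.\<close>
  define \<delta> where "\<delta> = (\<lambda>\<alpha>. if idx \<alpha> < l then int (d (idx \<alpha>)) else 0)"
  have idx: "idx \<alpha> \<le> l \<and> \<alpha> \<in> J (idx \<alpha>)" if "\<alpha> \<in> Poly_Mapping.keys P" for \<alpha>
  proof -
    have "\<exists>i. i \<le> l \<and> \<alpha> \<in> J i" using assms that unfolding complete_rado_functional_def by auto
    then show ?thesis unfolding idx_def by (rule someI_ex)
  qed
  show thesis
  proof (rule that)
    show "infinite {t. monochromatic c t \<and> t \<in> T}" if "finite_colouring c" for c
      using assms that unfolding complete_rado_functional_def T_def by simp
    fix t \<alpha> \<beta> assume t: "t \<in> T" and keys: "\<alpha> \<in> Poly_Mapping.keys P" "\<beta> \<in> Poly_Mapping.keys P"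
    obtain M where M: "\<And>i. i \<le> l \<Longrightarrow> J i = {\<alpha> \<in> Poly_Mapping.keys P. int (dotp \<alpha> t) = M i}"
      "\<And>i. i < l \<Longrightarrow> M i - M l = int (d i)"
      using t unfolding T_def by blast
    have "int (dotp \<gamma> t) = M l + \<delta> \<gamma>" if "\<gamma> \<in> Poly_Mapping.keys P" for \<gamma>
    proof (cases "idx \<gamma> < l")
      case True
      then show ?thesis using idx[OF that] M(1)[of "idx \<gamma>"] M(2)[of "idx \<gamma>"] by (auto simp: \<delta>_def)
    next
      case False
      then have "idx \<gamma> = l" using idx[OF that] by simp
      then show ?thesis using idx[OF that] M(1)[of l] by (auto simp: \<delta>_def)
    qed
    then show "int (dotp \<alpha> t) - int (dotp \<beta> t) = \<delta> \<alpha> - \<delta> \<beta>" using keys by simp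
  qed
qed

lemma three_distinct_UNIV:
  fixes i j l :: 3
  assumes "i \<noteq> j" "i \<noteq> l" "j \<noteq> l"
  shows "UNIV = {i, j, l}"
  using assms by (intro card_seteq[symmetric]) auto

lemma pair_in_3:
  fixes I :: "3 set"
  assumes "card I \<ge> 2" "I \<noteq> UNIV"
  obtains i j l where "i \<noteq> j" "i \<noteq> l" "j \<noteq> l" "I = {i, j}"
proof -
  have "card I < 3" using psubset_card_mono[of UNIV I] assms(2) by auto
  then have "card I = 2" using assms(1) by simp
  then obtain i j where ij: "I = {i, j}" "i \<noteq> j" by (auto simp: card_2_iff)
  obtain l where "l \<notin> I" using assms(2) by blast
  then show thesis using that[of i j l] ij by auto
qed

lemma card_ge_2_if_zero_sum:
  fixes u :: "'n::finite \<Rightarrow> int"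
  assumes "I \<noteq> {}" "\<forall>i\<in>I. u i \<noteq> 0" "sum u I = 0"
  shows "card I \<ge> 2"
proof (rule ccontr)
  assume "\<not> card I \<ge> 2"
  moreover have "card I > 0" using assms(1) by (simp add: card_gt_0_iff)
  ultimately have "card I = 1" by linarith
  then show False using assms(2,3) by (auto simp: card_1_singleton_iff)
qed

text \<open>The total sum rules out the full index set and nonvanishing rules out singletons. So
  \<open>I\<close> is a pair of opposite coefficients, and the third coefficient equals the positive
  total.\<close>

lemma zero_sum_pair:
  fixes u :: "3 \<Rightarrow> int"
  assumes "sum u UNIV > 0" "I \<noteq> {}" "\<forall>i\<in>I. u i \<noteq> 0" "sum u I = 0"
  obtains i j l where "i \<noteq> j" "i \<noteq> l" "j \<noteq> l" "u i > 0" "u j = - u i" "u l > 0"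
proof -
  have "card I \<ge> 2" by (rule card_ge_2_if_zero_sum[OF assms(2-4)])
  moreover have "I \<noteq> UNIV" using assms by auto
  ultimately obtain i j l where ijl: "i \<noteq> j" "i \<noteq> l" "j \<noteq> l" "I = {i, j}" by (rule pair_in_3)
  then have *: "u i \<noteq> 0" "u i + u j = 0" using assms by auto
  have "sum u UNIV = u i + u j + u l"
    unfolding three_distinct_UNIV[OF ijl(1-3)] using ijl by (simp add: algebra_simps)
  then have "u l > 0" using assms(1) * by simp
  consider "u i > 0" | "u j > 0" using * by linarith
  then show thesis
  proof cases
    case 1
    with that[of i j l] ijl * \<open>u l > 0\<close> show ?thesis by simp
  next
    case 2
    with that[of j i l] ijl * \<open>u l > 0\<close> show ?thesis by simp
  qed
qed

text \<open>Two independent forms span a form violating Rado's condition. If both sum to zero on a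
  common pair, eliminating that pair leaves a form in one variable; otherwise a generic combination
  works.\<close>

lemma nonzero_sum_combination:
  fixes v w :: "3 \<Rightarrow> int"
  assumes v: "sum v UNIV \<noteq> 0" and indep: "v p * w q \<noteq> v q * w p"
  shows "\<exists>u a b i. u = (\<lambda>x. a * v x + b * w x) \<and> u i \<noteq> 0 \<and>
    (\<forall>I. I \<noteq> {} \<and> (\<forall>x\<in>I. u x \<noteq> 0) \<longrightarrow> sum u I \<noteq> 0)"
proof (cases "\<exists>I. card I \<ge> 2 \<and> sum v I = 0 \<and> sum w I = 0")
  case True
  then obtain I where I: "card I \<ge> 2" "sum v I = 0" "sum w I = 0" by blast
  then have "I \<noteq> UNIV" using v by auto
  with I(1) obtain i j l where ijl: "i \<noteq> j" "i \<noteq> l" "j \<noteq> l" "I = {i, j}" by (rule pair_in_3)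
  have UN: "UNIV = {i, j, l}" by (rule three_distinct_UNIV[OF ijl(1-3)])
  \<comment> \<open>As \<open>v\<close> and \<open>w\<close> are each antisymmetric on the pair,
    cancelling the entry at \<open>i\<close> also cancels the one at \<open>j\<close>.\<close>
  define u where "u = (\<lambda>x. w i * v x + (- v i) * w x)"
  have "v j = - v i" "w j = - w i" using I ijl by auto
  then have u0: "u i = 0" "u j = 0" by (auto simp: u_def)
  \<comment> \<open>If \<open>u\<close> vanished altogether, independence would give
    \<open>v i = w i = 0\<close>; then both forms would involve only the index \<open>l\<close> and
    be dependent.\<close>
  have ul: "u l \<noteq> 0"
  proof
    assume "u l = 0"
    then have *: "w i * v x = v i * w x" for x
      using UNIV_I[of x] u0 unfolding UN by (auto simp: u_def)
    have "v i * (v p * w q) = v i * (v q * w p)" "w i * (v p * w q) = w i * (v q * w p)"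
      using *[of p] *[of q] by algebra+
    then have "v i = 0" "w i = 0" using indep by simp_all
    moreover have "p \<in> {i, j, l}" "q \<in> {i, j, l}" unfolding UN[symmetric] by auto
    ultimately show False using indep \<open>v j = - v i\<close> \<open>w j = - w i\<close> by auto
  qed
  have nz: "sum u I \<noteq> 0" if "I \<noteq> {}" "\<forall>i\<in>I. u i \<noteq> 0" for I
  proof -
    have "x = l" if "x \<in> I" for x
      using that \<open>\<forall>i\<in>I. u i \<noteq> 0\<close> u0 UNIV_I[of x] unfolding UN by auto
    then have "I = {l}" using that by blast
    then show ?thesis using ul by simp
  qed
  show ?thesis
    by (rule exI[of _ u], rule exI[of _ "w i"], rule exI[of _ "- v i"], rule exI[of _ l])
      (use u_def ul nz in blast)
next
  case False
  have fin: "finite {N. a + N * b = 0}" if "a \<noteq> 0 \<or> b \<noteq> 0" for a b :: int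
  proof (cases "b = 0")
    case False
    then have "{N. a + N * b = 0} \<subseteq> {- a div b}"
      by (auto simp: eq_neg_iff_add_eq_0[symmetric])
    then show ?thesis using finite_subset by blast
  qed (use that in simp)
  \<comment> \<open>Each set of at least two indices excludes at most one multiplier
    \<open>N\<close>, since the sums of \<open>v\<close> and \<open>w\<close> over it are not both
    zero. Singletons are harmless.\<close>
  have "finite (\<Union>I\<in>{I. card I \<ge> 2}. {N. sum w I + N * sum v I = 0})"
    using False by (intro finite_UN_I fin) auto
  then obtain N where N: "N \<notin> (\<Union>I\<in>{I. card I \<ge> 2}. {N. sum w I + N * sum v I = 0})"
    using ex_new_if_finite infinite_UNIV_int by blast
  define u where "u = (\<lambda>x. N * v x + 1 * w x)"
  have sum_u: "sum u I = sum w I + N * sum v I" for I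
    by (simp add: u_def sum.distrib sum_distrib_left)
  have "sum u I \<noteq> 0" if "card I \<ge> 2" for I using N that unfolding sum_u by blast
  then have nz: "\<forall>I. I \<noteq> {} \<and> (\<forall>x\<in>I. u x \<noteq> 0) \<longrightarrow> sum u I \<noteq> 0"
    using card_ge_2_if_zero_sum by blast
  have "sum u UNIV \<noteq> 0" using N unfolding sum_u by force
  then obtain i where ui: "u i \<noteq> 0" using sum.neutral by metis
  show ?thesis
    by (rule exI[of _ u], rule exI[of _ N], rule exI[of _ 1], rule exI[of _ i])
      (intro conjI u_def ui nz)
qed

text \<open>Two exponents of different degree give a direction \<open>v\<close> with nonzero total,
  and Rado's condition shapes it as \<open>(v i, - v i, v l)\<close>. A support difference not
  parallel to \<open>v\<close> would yield a forbidden combination.\<close>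

lemma crf_imp_line:
  assumes "\<not> homogeneous P" "complete_rado_functional P n J d"
  obtains i j l :: 3 and v :: "3 \<Rightarrow> int" where "i \<noteq> j" "i \<noteq> l" "j \<noteq> l" "v i > 0" "v j = - v i" "v l > 0"
    "\<And>\<gamma> \<beta> a b. \<lbrakk>\<gamma> \<in> Poly_Mapping.keys P; \<beta> \<in> Poly_Mapping.keys P\<rbrakk> \<Longrightarrow>
      v a * (int (\<gamma> $ b) - int (\<beta> $ b)) = v b * (int (\<gamma> $ a) - int (\<beta> $ a))"
proof -
  obtain T and \<delta> :: "nat ^ 3 \<Rightarrow> int" where T: "\<And>c. finite_colouring c \<Longrightarrow> infinite {t. monochromatic c t \<and> t \<in> T}"
    and \<delta>: "\<And>t \<alpha> \<beta>. \<lbrakk>t \<in> T; \<alpha> \<in> Poly_Mapping.keys P; \<beta> \<in> Poly_Mapping.keys P\<rbrakk>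
       \<Longrightarrow> int (dotp \<alpha> t) - int (dotp \<beta> t) = \<delta> \<alpha> - \<delta> \<beta>"
    using crf_fixed_differences[OF assms(2)] by blast
  \<comment> \<open>A form constant on \<open>T\<close> must have a zero subset sum: otherwise some
    colouring leaves only finitely many monochromatic points of \<open>T\<close>.\<close>
  have no_form: "\<exists>I. I \<noteq> {} \<and> (\<forall>i\<in>I. u i \<noteq> 0) \<and> sum u I = 0"
    if "u i1 \<noteq> 0" and e: "\<And>t. t \<in> T \<Longrightarrow> (\<Sum>i\<in>UNIV. u i * int (t $ i)) = e" for u :: "3 \<Rightarrow> int" and i1 e
  proof (rule ccontr)
    assume "\<not> ?thesis"
    then have "\<exists>c. finite_colouring c \<and>
        finite {t :: nat ^ 3. monochromatic c t \<and> (\<Sum>i\<in>UNIV. u i * int (t $ i)) = e}"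
      by (intro finite_monochromatic_linear_solutions[of u i1, OF that(1)]) blast
    then obtain c where c: "finite_colouring c"
      "finite {t :: nat ^ 3. monochromatic c t \<and> (\<Sum>i\<in>UNIV. u i * int (t $ i)) = e}"
      by blast
    have "{t. monochromatic c t \<and> t \<in> T}
        \<subseteq> {t. monochromatic c t \<and> (\<Sum>i\<in>UNIV. u i * int (t $ i)) = e}"
      using e by blast
    then show False using T[OF c(1)] c(2) finite_subset by blast
  qed
  define dif where "dif = (\<lambda>(\<gamma> :: nat ^ 3) (\<beta> :: nat ^ 3) a. int (\<gamma> $ a) - int (\<beta> $ a))"
  have dif: "(\<Sum>i\<in>UNIV. dif \<gamma> \<beta> i * int (t $ i)) = \<delta> \<gamma> - \<delta> \<beta>"
    if "t \<in> T" "\<gamma> \<in> Poly_Mapping.keys P" "\<beta> \<in> Poly_Mapping.keys P" for t \<gamma> \<beta>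
    using \<delta>[OF that] by (simp add: dif_def dotp_def algebra_simps sum_subtractf)
  obtain \<alpha> \<beta> where keys: "\<alpha> \<in> Poly_Mapping.keys P" "\<beta> \<in> Poly_Mapping.keys P"
    and "(\<Sum>j\<in>UNIV. \<alpha> $ j) > (\<Sum>j\<in>UNIV. \<beta> $ j)"
    using assms(1) unfolding homogeneous_def by (auto simp: neq_iff)
  then have "(\<Sum>j\<in>UNIV. int (\<alpha> $ j)) > (\<Sum>j\<in>UNIV. int (\<beta> $ j))"
    by (simp flip: of_nat_sum)
  define v where "v = dif \<alpha> \<beta>"
  have sum_v: "sum v UNIV > 0"
    using \<open>(\<Sum>j\<in>UNIV. int (\<alpha> $ j)) > _\<close> by (simp add: v_def dif_def sum_subtractf)
  then obtain i1 where "v i1 \<noteq> 0" using sum.neutral by (metis less_irrefl)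
  from no_form[OF this dif[OF _ keys, folded v_def]]
  obtain I where I: "I \<noteq> {}" "\<forall>i\<in>I. v i \<noteq> 0" "sum v I = 0" by blast
  obtain i j l where ijl: "i \<noteq> j" "i \<noteq> l" "j \<noteq> l" "v i > 0" "v j = - v i" "v l > 0"
    using zero_sum_pair[OF sum_v I] by blast
  have par: "v a * dif \<gamma> \<beta> b = v b * dif \<gamma> \<beta> a" if "\<gamma> \<in> Poly_Mapping.keys P" for \<gamma> a b
  proof (rule ccontr)
    assume "v a * dif \<gamma> \<beta> b \<noteq> v b * dif \<gamma> \<beta> a"
    from sum_v have "sum v UNIV \<noteq> 0" by simp
    from nonzero_sum_combination[OF this \<open>v a * dif \<gamma> \<beta> b \<noteq> v b * dif \<gamma> \<beta> a\<close>] obtain u x y i where u: "u = (\<lambda>a. x * v a + y * dif \<gamma> \<beta> a)" "u i \<noteq> 0"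
      "\<And>I. I \<noteq> {} \<and> (\<forall>i\<in>I. u i \<noteq> 0) \<longrightarrow> sum u I \<noteq> 0"
      by blast
    \<comment> \<open>Integer combinations of forms constant on \<open>T\<close> are again constant
      on \<open>T\<close>.\<close>
    have "(\<Sum>i\<in>UNIV. u i * int (t $ i)) = x * (\<delta> \<alpha> - \<delta> \<beta>) + y * (\<delta> \<gamma> - \<delta> \<beta>)"
      if "t \<in> T" for t
    proof -
      have "(\<Sum>i\<in>UNIV. u i * int (t $ i)) =
        x * (\<Sum>i\<in>UNIV. v i * int (t $ i)) + y * (\<Sum>i\<in>UNIV. dif \<gamma> \<beta> i * int (t $ i))"
        by (simp add: u(1) distrib_right sum.distrib sum_distrib_left mult.assoc)
      then show ?thesis
        using dif[OF that keys] dif[OF that \<open>\<gamma> \<in> _\<close> keys(2)] by (simp add: v_def)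
    qed
    then show False using no_form[of u i] u(2,3) by blast
  qed
  show thesis
  proof (rule that[OF ijl])
    fix \<gamma> \<gamma>' a b assume "\<gamma> \<in> Poly_Mapping.keys P" "\<gamma>' \<in> Poly_Mapping.keys P"
    from par[OF this(1), of a b] par[OF this(2), of a b]
    show "v a * (int (\<gamma> $ b) - int (\<gamma>' $ b)) = v b * (int (\<gamma> $ a) - int (\<gamma>' $ a))"
      by (simp add: dif_def algebra_simps)
  qed
qed

section \<open>Permuting variables\<close>

lemma lookup_permute_vars:
  assumes "bij \<sigma>"
  shows "Poly_Mapping.lookup (permute_vars \<sigma> P) \<alpha> = Poly_Mapping.lookup P (\<chi> j. \<alpha> $ \<sigma> j)"
proof -
  have "inj (\<lambda>\<alpha> :: nat ^ 'a. \<chi> j. \<alpha> $ \<sigma> j)"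
    using bij_is_surj[OF assms] by (auto simp: inj_def vec_eq_iff surj_def) metis
  then show ?thesis unfolding permute_vars_def by (simp add: map_key.rep_eq)
qed

lemma keys_permute_vars_iff:
  assumes "bij \<sigma>"
  shows "\<alpha> \<in> Poly_Mapping.keys (permute_vars \<sigma> P) \<longleftrightarrow> (\<chi> j. \<alpha> $ \<sigma> j) \<in> Poly_Mapping.keys P"
  by (simp add: lookup_permute_vars[OF assms] in_keys_iff)

lemma bij_betw_keys_permute_vars:
  assumes "bij \<sigma>"
  shows "bij_betw (\<lambda>\<alpha>. \<chi> j. \<alpha> $ \<sigma> j) (Poly_Mapping.keys (permute_vars \<sigma> P)) (Poly_Mapping.keys P)"
proof (rule bij_betwI[where g = "\<lambda>\<alpha>. \<chi> j. \<alpha> $ inv \<sigma> j"])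
  have *: "\<sigma> (inv \<sigma> j) = j" "inv \<sigma> (\<sigma> j) = j" for j
    using assms by (simp_all add: bij_is_surj surj_f_inv_f bij_is_inj)
  show "(\<lambda>\<alpha>. \<chi> j. \<alpha> $ \<sigma> j) \<in> Poly_Mapping.keys (permute_vars \<sigma> P) \<rightarrow> Poly_Mapping.keys P"
    by (simp add: keys_permute_vars_iff[OF assms])
  show "(\<lambda>\<alpha>. \<chi> j. \<alpha> $ inv \<sigma> j) \<in> Poly_Mapping.keys P \<rightarrow> Poly_Mapping.keys (permute_vars \<sigma> P)"
    by (simp add: keys_permute_vars_iff[OF assms] *)
qed (simp_all add: assms bij_is_surj surj_f_inv_f bij_is_inj)

lemma homogeneous_permute_vars:
  assumes "bij \<sigma>" "homogeneous (permute_vars \<sigma> P)"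
  shows "homogeneous P"
proof -
  have sum: "(\<Sum>j\<in>UNIV. (\<chi> j. \<alpha> $ \<sigma> j) $ j) = (\<Sum>j\<in>UNIV. \<alpha> $ j)" for \<alpha> :: "nat ^ 'a"
    using assms(1) by (simp add: sum.reindex_bij_betw)
  have "Poly_Mapping.keys P = (\<lambda>\<alpha>. \<chi> j. \<alpha> $ \<sigma> j) ` Poly_Mapping.keys (permute_vars \<sigma> P)"
    using bij_betw_keys_permute_vars[OF assms(1)] by (metis bij_betw_imp_surj_on)
  then show ?thesis using assms(2) unfolding homogeneous_def by (simp only: ball_simps sum)
qed

lemma eval_permute_vars:
  fixes x :: "'a::comm_ring_1 ^ 'n::finite"
  assumes "bij \<sigma>"
  shows "eval_mpoly (permute_vars \<sigma> P) x = eval_mpoly P (\<chi> j. x $ \<sigma> j)"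
proof -
  have "(\<Prod>j\<in>UNIV. (\<chi> j. x $ \<sigma> j) $ j ^ (\<chi> j. \<alpha> $ \<sigma> j) $ j) = (\<Prod>j\<in>UNIV. x $ j ^ \<alpha> $ j)" for \<alpha> :: "nat ^ 'n"
    using prod.reindex_bij_betw[OF assms, of "\<lambda>j. x $ j ^ \<alpha> $ j"] by simp
  then have "eval_mpoly (permute_vars \<sigma> P) x = (\<Sum>\<alpha>\<in>Poly_Mapping.keys (permute_vars \<sigma> P).
     of_int (Poly_Mapping.lookup P (\<chi> j. \<alpha> $ \<sigma> j)) *
       (\<Prod>j\<in>UNIV. (\<chi> j. x $ \<sigma> j) $ j ^ (\<chi> j. \<alpha> $ \<sigma> j) $ j))"
    unfolding eval_mpoly_def lookup_permute_vars[OF assms] by simp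
  also have "\<dots> = eval_mpoly P (\<chi> j. x $ \<sigma> j)"
    unfolding eval_mpoly_def
    by (rule sum.reindex_bij_betw[OF bij_betw_keys_permute_vars[OF assms]])
  finally show ?thesis .
qed

lemma monochromatic_permute:
  assumes "bij \<sigma>"
  shows "monochromatic c (\<chi> j. t $ \<sigma> j) \<longleftrightarrow> monochromatic c t"
  unfolding monochromatic_def using bij_is_surj[OF assms] by (auto simp: surj_def) metis+

lemma partition_regular_permute_vars:
  assumes "bij \<sigma>"
  shows "partition_regular (permute_vars \<sigma> P) \<longleftrightarrow> partition_regular P"
proof -
  have *: "\<sigma> (inv \<sigma> j) = j" "inv \<sigma> (\<sigma> j) = j" for j
    using assms by (simp_all add: bij_is_surj surj_f_inv_f bij_is_inj)
  have "(\<exists>t. monochromatic c t \<and> eval_mpoly (permute_vars \<sigma> P) (\<chi> j. int (t $ j)) = 0) \<longleftrightarrow>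
    (\<exists>t. monochromatic c t \<and> eval_mpoly P (\<chi> j. int (t $ j)) = 0)" for c
  proof
    assume "\<exists>t. monochromatic c t \<and> eval_mpoly (permute_vars \<sigma> P) (\<chi> j. int (t $ j)) = 0"
    then obtain t where "monochromatic c t" "eval_mpoly (permute_vars \<sigma> P) (\<chi> j. int (t $ j)) = 0" by blast
    then show "\<exists>t. monochromatic c t \<and> eval_mpoly P (\<chi> j. int (t $ j)) = 0"
      by (intro exI[of _ "\<chi> j. t $ \<sigma> j"])
        (simp add: monochromatic_permute[OF assms] eval_permute_vars[OF assms])
  next
    assume "\<exists>t. monochromatic c t \<and> eval_mpoly P (\<chi> j. int (t $ j)) = 0"
    then obtain t where "monochromatic c t" "eval_mpoly P (\<chi> j. int (t $ j)) = 0" by blast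
    then show "\<exists>t. monochromatic c t \<and> eval_mpoly (permute_vars \<sigma> P) (\<chi> j. int (t $ j)) = 0"
      by (intro exI[of _ "\<chi> j. t $ inv \<sigma> j"])
        (simp add: monochromatic_permute[OF bij_imp_bij_inv[OF assms]] eval_permute_vars[OF assms] *)
  qed
  then show ?thesis unfolding partition_regular_def by simp
qed

section \<open>Supports on a line\<close>

lemma prod_UNIV_3: "prod f (UNIV :: 3 set) = f 1 * f 2 * f 3"
  unfolding UNIV_3 by (simp add: mult.assoc)

lemma prod_UNIV_2: "prod f (UNIV :: 2 set) = f 1 * f 2"
  unfolding UNIV_2 by simp

text \<open>On the line the third exponent is determined by the first. So forgetting it loses no
  monomial, and \<open>H\<close> is the projected polynomial with the same coefficients;
  \<open>a\<close> and \<open>r\<close> are the first and third exponents of the base point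
  \<open>\<beta>\<close>.\<close>

lemma rado_form_if_line:
  fixes P :: "(3, int) mpoly" and \<rho> :: rat
  assumes \<beta>: "\<beta> \<in> Poly_Mapping.keys P" "\<beta> $ 1 > 0" "\<beta> $ 3 > 0"
    and line: "\<And>\<alpha>. \<alpha> \<in> Poly_Mapping.keys P \<Longrightarrow> \<alpha> $ 1 + \<alpha> $ 2 = \<beta> $ 1 + \<beta> $ 2"
      "\<And>\<alpha>. \<alpha> \<in> Poly_Mapping.keys P \<Longrightarrow>
        real (\<alpha> $ 3) = real (\<beta> $ 3) + real_of_rat \<rho> * (real (\<alpha> $ 1) - real (\<beta> $ 1))"
  shows "\<exists>r a H. rado_form P r a \<rho> H"
proof -
  define pr :: "nat ^ 3 \<Rightarrow> nat ^ 2" where "pr = (\<lambda>\<alpha>. vector [\<alpha> $ 1, \<alpha> $ 2])"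
  define H where "H = (\<Sum>\<alpha>\<in>Poly_Mapping.keys P. Poly_Mapping.single (pr \<alpha>) (Poly_Mapping.lookup P \<alpha>))"
  have pr: "pr \<alpha> $ 1 = \<alpha> $ 1" "pr \<alpha> $ 2 = \<alpha> $ 2" for \<alpha> by (simp_all add: pr_def)
  have inj: "inj_on pr (Poly_Mapping.keys P)"
  proof (rule inj_onI)
    fix \<alpha> \<gamma> assume *: "\<alpha> \<in> Poly_Mapping.keys P" "\<gamma> \<in> Poly_Mapping.keys P" "pr \<alpha> = pr \<gamma>"
    then have "\<alpha> $ 1 = \<gamma> $ 1" "\<alpha> $ 2 = \<gamma> $ 2" using pr by metis+
    moreover from this have "real (\<alpha> $ 3) = real (\<gamma> $ 3)" using line(2) * by simp
    ultimately show "\<alpha> = \<gamma>" by (simp add: vec_eq_iff forall_3)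
  qed
  have lookup: "Poly_Mapping.lookup H (pr \<alpha>) = Poly_Mapping.lookup P \<alpha>" if "\<alpha> \<in> Poly_Mapping.keys P" for \<alpha>
  proof -
    have "Poly_Mapping.lookup H (pr \<alpha>) =
      (\<Sum>\<gamma>\<in>Poly_Mapping.keys P. if \<gamma> = \<alpha> then Poly_Mapping.lookup P \<gamma> else 0)"
      unfolding H_def lookup_sum using inj that
      by (intro sum.cong) (auto simp: lookup_single when_def inj_on_eq_iff)
    then show ?thesis using that by simp
  qed
  have "Poly_Mapping.keys H \<subseteq> pr ` Poly_Mapping.keys P"
    unfolding H_def by (rule order.trans[OF keys_sum]) auto
  moreover have "pr ` Poly_Mapping.keys P \<subseteq> Poly_Mapping.keys H"
    using lookup by (auto simp: in_keys_iff)
  ultimately have keys_H: "Poly_Mapping.keys H = pr ` Poly_Mapping.keys P" by blast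
  have "rado_form P (\<beta> $ 3) (\<beta> $ 1) \<rho> H"
    unfolding rado_form_def
  proof (intro conjI allI impI)
    show "homogeneous H" unfolding homogeneous_def keys_H by (simp add: sum_2 pr line(1))
    fix x y z :: real assume pos: "x > 0 \<and> y > 0 \<and> z > 0"
    \<comment> \<open>The line equation, written multiplicatively for powers of
      \<open>z\<close>.\<close>
    have exponent: "z ^ (\<alpha> $ 3) = z powr (real (\<beta> $ 3) - real (\<beta> $ 1) * real_of_rat \<rho>) * (z powr real_of_rat \<rho>) ^ (\<alpha> $ 1)"
      if "\<alpha> \<in> Poly_Mapping.keys P" for \<alpha>
    proof -
      have "z ^ (\<alpha> $ 3) = z powr real (\<alpha> $ 3)" using pos by (simp add: powr_realpow)
      also have "real (\<alpha> $ 3) = (real (\<beta> $ 3) - real (\<beta> $ 1) * real_of_rat \<rho>) + real_of_rat \<rho> * real (\<alpha> $ 1)"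
        using line(2)[OF that] by (simp add: algebra_simps)
      also have "z powr \<dots> = z powr (real (\<beta> $ 3) - real (\<beta> $ 1) * real_of_rat \<rho>) * (z powr real_of_rat \<rho>) ^ (\<alpha> $ 1)"
        using pos by (simp add: powr_add powr_powr flip: powr_realpow)
      finally show ?thesis .
    qed
    have "eval_mpoly H (vector [x * z powr real_of_rat \<rho>, y]) =
      (\<Sum>\<alpha>\<in>Poly_Mapping.keys P. of_int (Poly_Mapping.lookup P \<alpha>) * ((x * z powr real_of_rat \<rho>) ^ (\<alpha> $ 1) * y ^ (\<alpha> $ 2)))"
      unfolding eval_mpoly_def keys_H by (subst sum.reindex[OF inj]) (simp add: lookup prod_UNIV_2 pr)
    then show "eval_mpoly P (vector [x, y, z]) =
          z powr (real (\<beta> $ 3) - real (\<beta> $ 1) * real_of_rat \<rho>) * eval_mpoly H (vector [x * z powr real_of_rat \<rho>, y])"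
      by (simp add: eval_mpoly_def prod_UNIV_3 sum_distrib_left exponent power_mult_distrib mult_ac)
  qed (use \<beta> in auto)
  then show ?thesis by blast
qed

text \<open>The direction \<open>(v i, - v i, v l)\<close> is normalised to
  \<open>(1, -1, \<rho>)\<close> with \<open>\<rho> = v l / v i\<close>, after renaming
  \<open>i\<close>, \<open>j\<close>, \<open>l\<close> to 1, 2, 3.\<close>

lemma rado_form_if_crf:
  assumes "\<not> homogeneous P" "complete_rado_functional P n J d"
  shows "\<exists>\<sigma> r a \<rho> H. bij \<sigma> \<and> rado_form (permute_vars \<sigma> P) r a \<rho> H"
proof -
  obtain i j l :: 3 and v :: "3 \<Rightarrow> int" where ijl: "i \<noteq> j" "i \<noteq> l" "j \<noteq> l"
    and v: "v i > 0" "v j = - v i" "v l > 0"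
    and line: "\<And>\<gamma> \<beta> a b. \<lbrakk>\<gamma> \<in> Poly_Mapping.keys P; \<beta> \<in> Poly_Mapping.keys P\<rbrakk> \<Longrightarrow>
      v a * (int (\<gamma> $ b) - int (\<beta> $ b)) = v b * (int (\<gamma> $ a) - int (\<beta> $ a))"
    using crf_imp_line[OF assms] by blast
  have UN: "UNIV = {i, j, l}" by (rule three_distinct_UNIV[OF ijl])
  define \<sigma> :: "3 \<Rightarrow> 3" where "\<sigma> = (\<lambda>m. if m = i then 1 else if m = j then 2 else 3)"
  have \<sigma>: "\<sigma> i = 1" "\<sigma> j = 2" "\<sigma> l = 3" using ijl by (auto simp: \<sigma>_def)
  have "surj \<sigma>"
  proof -
    have "x \<in> range \<sigma>" for x using exhaust_3[of x] \<sigma> by (metis rangeI)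
    then show ?thesis by blast
  qed
  then have bij: "bij \<sigma>" by (simp add: bij_def finite_UNIV_surj_inj)
  \<comment> \<open>This base point makes \<open>r\<close> and \<open>a\<close> positive. As
    \<open>v i\<close> and \<open>v l\<close> are both positive, the exponents at \<open>i\<close>
    and \<open>l\<close> increase together along the line, so any support point above another one
    has both positive.\<close>
  have "\<exists>\<beta>\<in>Poly_Mapping.keys P. \<beta> $ i > 0 \<and> \<beta> $ l > 0"
  proof -
    have *: "\<exists>\<beta>\<in>Poly_Mapping.keys P. \<beta> $ i > 0 \<and> \<beta> $ l > 0"
      if "\<gamma> \<in> Poly_Mapping.keys P" "\<beta> \<in> Poly_Mapping.keys P" "\<gamma> $ i > \<beta> $ i" for \<gamma> \<beta>
    proof -
      have "v i * (int (\<gamma> $ l) - int (\<beta> $ l)) = v l * (int (\<gamma> $ i) - int (\<beta> $ i))"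
        by (rule line[OF that(1,2)])
      also have "\<dots> > 0" using v that(3) by simp
      finally have "\<gamma> $ l > \<beta> $ l" using v(1) by (simp add: zero_less_mult_iff)
      then show ?thesis using that by (intro bexI[of _ \<gamma>]) auto
    qed
    obtain \<gamma> \<beta> where keys: "\<gamma> \<in> Poly_Mapping.keys P" "\<beta> \<in> Poly_Mapping.keys P"
      and ne: "(\<Sum>j\<in>UNIV. \<gamma> $ j) \<noteq> (\<Sum>j\<in>UNIV. \<beta> $ j)"
      using assms(1) unfolding homogeneous_def by blast
    have "\<gamma> $ i \<noteq> \<beta> $ i"
    proof
      assume "\<gamma> $ i = \<beta> $ i"
      then have "v i * (int (\<gamma> $ b) - int (\<beta> $ b)) = 0" for b using line[OF keys, of i b] by simp
      then have "\<gamma> $ b = \<beta> $ b" for b using v(1) by simp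
      then show False using ne by simp
    qed
    then show ?thesis using *[OF keys] *[OF keys(2,1)] by linarith
  qed
  then obtain \<beta>' where \<beta>': "\<beta>' \<in> Poly_Mapping.keys P" "\<beta>' $ i > 0" "\<beta>' $ l > 0" by blast
  from \<beta>'(1) have "\<beta>' \<in> (\<lambda>\<alpha>. \<chi> j. \<alpha> $ \<sigma> j) ` Poly_Mapping.keys (permute_vars \<sigma> P)"
    by (simp only: bij_betw_imp_surj_on[OF bij_betw_keys_permute_vars[OF bij]])
  then obtain \<beta> where \<beta>: "\<beta>' = (\<chi> j. \<beta> $ \<sigma> j)" "\<beta> \<in> Poly_Mapping.keys (permute_vars \<sigma> P)"
    by (rule imageE)
  have \<beta>_eq: "\<beta>' $ i = \<beta> $ 1" "\<beta>' $ j = \<beta> $ 2" "\<beta>' $ l = \<beta> $ 3"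
    using \<sigma> by (simp_all add: \<beta>(1))
  have par: "v a * (int (\<alpha> $ \<sigma> b) - int (\<beta> $ \<sigma> b)) = v b * (int (\<alpha> $ \<sigma> a) - int (\<beta> $ \<sigma> a))"
    if "\<alpha> \<in> Poly_Mapping.keys (permute_vars \<sigma> P)" for \<alpha> a b
    using line[of "\<chi> j. \<alpha> $ \<sigma> j" "\<chi> j. \<beta> $ \<sigma> j" a b] that \<beta>(2)
    by (simp add: keys_permute_vars_iff[OF bij])
  have "\<exists>r a H. rado_form (permute_vars \<sigma> P) r a (of_int (v l) / of_int (v i)) H"
  proof (rule rado_form_if_line[OF \<beta>(2)])
    show "\<beta> $ 1 > 0" "\<beta> $ 3 > 0" using \<beta>' \<beta>_eq by simp_all
    fix \<alpha> assume \<alpha>: "\<alpha> \<in> Poly_Mapping.keys (permute_vars \<sigma> P)"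
    have "v i * (int (\<alpha> $ 2) - int (\<beta> $ 2)) = v i * (int (\<beta> $ 1) - int (\<alpha> $ 1))"
      using par[OF \<alpha>, of i j] v(2) \<sigma> by (simp add: algebra_simps)
    then show "\<alpha> $ 1 + \<alpha> $ 2 = \<beta> $ 1 + \<beta> $ 2" using v(1) by simp
    have "real_of_int (v i * (int (\<alpha> $ 3) - int (\<beta> $ 3))) = real_of_int (v l * (int (\<alpha> $ 1) - int (\<beta> $ 1)))"
      using par[OF \<alpha>, of i l] \<sigma> by simp
    then show "real (\<alpha> $ 3) = real (\<beta> $ 3)
        + real_of_rat (of_int (v l) / of_int (v i)) * (real (\<alpha> $ 1) - real (\<beta> $ 1))"
      using v(1) by (simp add: of_rat_divide field_simps)
  qed
  then show ?thesis using bij by blast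
qed

section \<open>Comparing coefficients of sums of real powers\<close>

lemma powr_linear_independent:
  fixes C :: "real \<Rightarrow> real"
  assumes "finite F" "\<And>x. x > 0 \<Longrightarrow> (\<Sum>e\<in>F. C e * x powr e) = 0" "e \<in> F"
  shows "C e = 0"
  using assms
proof (induction F arbitrary: e rule: finite_linorder_max_induct)
  case (insert b F)
  have "b \<notin> F" using insert.hyps by blast
  \<comment> \<open>After division by the dominant power \<open>x powr b\<close>, all other terms
    vanish at infinity, which isolates \<open>C b\<close>.\<close>
  have "((\<lambda>x. \<Sum>e\<in>F. C e * x powr (e - b)) \<longlongrightarrow> (\<Sum>e\<in>F. C e * 0)) at_top"
    using insert.hyps by (intro tendsto_sum tendsto_mult tendsto_const tendsto_neg_powr filterlim_ident) auto
  moreover have "\<forall>\<^sub>F x in at_top. (\<Sum>e\<in>F. C e * x powr (e - b)) = - C b"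
    using eventually_gt_at_top[of 0]
  proof eventually_elim
    case (elim x)
    have "C b * x powr b + (\<Sum>e\<in>F. C e * x powr e) = 0"
      using insert.prems(1)[OF elim] insert.hyps \<open>b \<notin> F\<close> by simp
    moreover have "(\<Sum>e\<in>F. C e * x powr (e - b)) = (\<Sum>e\<in>F. C e * x powr e) / x powr b"
      by (simp add: powr_diff sum_divide_distrib)
    ultimately show ?case using elim by (simp add: field_simps add_eq_0_iff)
  qed
  ultimately have "((\<lambda>x. - C b) \<longlongrightarrow> 0) (at_top :: real filter)"
    by (simp add: tendsto_cong)
  then have Cb: "C b = 0" by (simp add: tendsto_const_iff)
  then have "C e = 0" if "e \<in> F" for e
    using insert.IH[of e] insert.prems(1) insert.hyps \<open>b \<notin> F\<close> that by simp
  then show ?case using Cb insert.prems(2) by blast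
qed simp

text \<open>Version with repeated exponents, obtained by first grouping equal ones.\<close>

lemma powr_coefficients_zero:
  fixes c f :: "'a \<Rightarrow> real"
  assumes "finite A" "\<And>x. x > 0 \<Longrightarrow> (\<Sum>a\<in>A. c a * x powr f a) = 0"
  shows "(\<Sum>a | a \<in> A \<and> f a = e. c a) = 0"
proof (cases "e \<in> f ` A")
  case True
  show ?thesis
  proof (rule powr_linear_independent[of "f ` A" "\<lambda>e. \<Sum>a | a \<in> A \<and> f a = e. c a", OF _ _ True])
    fix x :: real assume "x > 0"
    have "(\<Sum>e\<in>f ` A. (\<Sum>a | a \<in> A \<and> f a = e. c a) * x powr e)
        = (\<Sum>e\<in>f ` A. \<Sum>a | a \<in> A \<and> f a = e. c a * x powr f a)"
      by (intro sum.cong) (auto simp: sum_distrib_right)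
    also have "\<dots> = 0"
      by (rule trans[OF sum.image_gen[OF assms(1), symmetric] assms(2)[OF \<open>x > 0\<close>]])
    finally show "(\<Sum>e\<in>f ` A. (\<Sum>a | a \<in> A \<and> f a = e. c a) * x powr e) = 0" .
  qed (use assms(1) in simp)
next
  case False
  then have "{a \<in> A. f a = e} = {}" by blast
  then show ?thesis by (simp only: sum.empty)
qed

text \<open>The identity of functions becomes an identity of monomials by comparing coefficients in
  \<open>x\<close>, then \<open>y\<close>, then \<open>z\<close>. Real exponents are needed since
  those of \<open>z\<close> on the side of \<open>H\<close> involve \<open>\<rho>\<close>.\<close>

lemma rado_form_keys:
  assumes "rado_form P r a \<rho> H" "\<alpha> \<in> Poly_Mapping.keys P"
  obtains \<eta> where "\<eta> \<in> Poly_Mapping.keys H" "\<alpha> $ 1 = \<eta> $ 1" "\<alpha> $ 2 = \<eta> $ 2"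
    "real (\<alpha> $ 3) = real r - real a * real_of_rat \<rho> + real_of_rat \<rho> * real (\<eta> $ 1)"
proof -
  define s where "s = real r - real a * real_of_rat \<rho>"
  \<comment> \<open>A disjoint union, so that the monomials of both sides can be subtracted within
    one sum without being merged.\<close>
  define A where "A = Poly_Mapping.keys P <+> Poly_Mapping.keys H"
  define c where "c = case_sum (\<lambda>\<alpha>. real_of_int (Poly_Mapping.lookup P \<alpha>))
    (\<lambda>\<eta>. - real_of_int (Poly_Mapping.lookup H \<eta>))"
  define e1 where "e1 = case_sum (\<lambda>\<alpha> :: nat ^ 3. real (\<alpha> $ 1)) (\<lambda>\<eta> :: nat ^ 2. real (\<eta> $ 1))"
  define e2 where "e2 = case_sum (\<lambda>\<alpha> :: nat ^ 3. real (\<alpha> $ 2)) (\<lambda>\<eta> :: nat ^ 2. real (\<eta> $ 2))"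
  define e3 where "e3 = case_sum (\<lambda>\<alpha> :: nat ^ 3. real (\<alpha> $ 3)) (\<lambda>\<eta> :: nat ^ 2. s + real_of_rat \<rho> * real (\<eta> $ 1))"
  have fin: "finite A" by (simp add: A_def)
  have zero: "(\<Sum>u\<in>A. (c u * z powr e3 u * y powr e2 u) * x powr e1 u) = 0" if "x > 0" "y > 0" "z > 0" for x y z :: real
  proof -
    have "(\<Sum>\<alpha>\<in>Poly_Mapping.keys P. c (Inl \<alpha>) * z powr e3 (Inl \<alpha>) * y powr e2 (Inl \<alpha>) * x powr e1 (Inl \<alpha>))
       = eval_mpoly P (vector [x, y, z])"
      using that by (simp add: eval_mpoly_def prod_UNIV_3 c_def e1_def e2_def e3_def powr_realpow mult_ac)
    moreover have "(\<Sum>\<eta>\<in>Poly_Mapping.keys H. c (Inr \<eta>) * z powr e3 (Inr \<eta>) * y powr e2 (Inr \<eta>) * x powr e1 (Inr \<eta>))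
       = - (z powr s * eval_mpoly H (vector [x * z powr real_of_rat \<rho>, y]))"
      unfolding eval_mpoly_def sum_distrib_left sum_negf[symmetric]
    proof (intro sum.cong refl)
      fix \<eta> :: "nat ^ 2"
      have "z powr (s + real_of_rat \<rho> * real (\<eta> $ 1)) = z powr s * (z powr real_of_rat \<rho>) ^ (\<eta> $ 1)"
        using that by (simp add: powr_add powr_powr flip: powr_realpow)
      then show "c (Inr \<eta>) * z powr e3 (Inr \<eta>) * y powr e2 (Inr \<eta>) * x powr e1 (Inr \<eta>) =
        - (z powr s * (real_of_int (Poly_Mapping.lookup H \<eta>) *
          (\<Prod>j\<in>UNIV. vector [x * z powr real_of_rat \<rho>, y] $ j ^ \<eta> $ j)))"
        using that by (simp add: prod_UNIV_2 c_def e1_def e2_def e3_def powr_realpow power_mult_distrib mult_ac)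
    qed
    moreover have "eval_mpoly P (vector [x, y, z]) = z powr s * eval_mpoly H (vector [x * z powr real_of_rat \<rho>, y])"
      using assms(1) that unfolding rado_form_def s_def by blast
    ultimately show ?thesis unfolding A_def by (subst sum.Plus) simp_all
  qed
  have zero1: "(\<Sum>u | u \<in> A \<and> e1 u = \<alpha> $ 1. (c u * z powr e3 u) * y powr e2 u) = 0"
    if "y > 0" "z > 0" for y z
    by (rule powr_coefficients_zero[OF fin zero]) (use that in simp_all)
  have zero2: "(\<Sum>u | u \<in> {u. u \<in> A \<and> e1 u = \<alpha> $ 1} \<and> e2 u = \<alpha> $ 2. c u * z powr e3 u) = 0" if "z > 0" for z
    by (rule powr_coefficients_zero[OF _ zero1]) (use that fin in simp_all)
  have sum0: "(\<Sum>u | u \<in> {u. u \<in> {u. u \<in> A \<and> e1 u = \<alpha> $ 1} \<and> e2 u = \<alpha> $ 2} \<and> e3 u = \<alpha> $ 3. c u) = 0"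
    by (rule powr_coefficients_zero[OF _ zero2]) (use fin in simp_all)
  have "\<exists>\<eta>\<in>Poly_Mapping.keys H. e1 (Inr \<eta>) = \<alpha> $ 1 \<and> e2 (Inr \<eta>) = \<alpha> $ 2 \<and> e3 (Inr \<eta>) = \<alpha> $ 3"
  proof (rule ccontr)
    assume no: "\<not> ?thesis"
    \<comment> \<open>Without a partner in \<open>H\<close>, the coefficient of
      \<open>\<alpha>\<close> would be alone in its group, yet it is nonzero.\<close>
    have "{u. u \<in> {u. u \<in> {u. u \<in> A \<and> e1 u = \<alpha> $ 1} \<and> e2 u = \<alpha> $ 2} \<and> e3 u = \<alpha> $ 3} = {Inl \<alpha>}"
    proof (intro equalityI subsetI)
      fix u assume u: "u \<in> {u. u \<in> {u. u \<in> {u. u \<in> A \<and> e1 u = \<alpha> $ 1} \<and> e2 u = \<alpha> $ 2} \<and> e3 u = \<alpha> $ 3}"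
      then show "u \<in> {Inl \<alpha>}"
        using no by (cases u) (auto simp: A_def e1_def e2_def e3_def vec_eq_iff forall_3)
    qed (use assms(2) in \<open>auto simp: A_def e1_def e2_def e3_def\<close>)
    then show False using sum0 assms(2) by (simp add: c_def in_keys_iff)
  qed
  then show thesis using that unfolding e1_def e2_def e3_def s_def by auto
qed

lemma rado_form_line:
  assumes "rado_form P r a \<rho> H" "\<alpha> \<in> Poly_Mapping.keys P" "\<beta> \<in> Poly_Mapping.keys P"
  shows "\<alpha> $ 1 + \<alpha> $ 2 = \<beta> $ 1 + \<beta> $ 2"
    and "real (\<alpha> $ 3) - real (\<beta> $ 3) = real_of_rat \<rho> * (real (\<alpha> $ 1) - real (\<beta> $ 1))"
proof -
  obtain \<eta> where \<eta>: "\<eta> \<in> Poly_Mapping.keys H" "\<alpha> $ 1 = \<eta> $ 1" "\<alpha> $ 2 = \<eta> $ 2"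
    "real (\<alpha> $ 3) = real r - real a * real_of_rat \<rho> + real_of_rat \<rho> * real (\<eta> $ 1)"
    by (rule rado_form_keys[OF assms(1,2)])
  obtain \<theta> where \<theta>: "\<theta> \<in> Poly_Mapping.keys H" "\<beta> $ 1 = \<theta> $ 1" "\<beta> $ 2 = \<theta> $ 2"
    "real (\<beta> $ 3) = real r - real a * real_of_rat \<rho> + real_of_rat \<rho> * real (\<theta> $ 1)"
    by (rule rado_form_keys[OF assms(1,3)])
  from \<eta> \<theta> show "real (\<alpha> $ 3) - real (\<beta> $ 3) = real_of_rat \<rho> * (real (\<alpha> $ 1) - real (\<beta> $ 1))"
    by (simp add: algebra_simps)
  have "homogeneous H" using assms(1) by (simp add: rado_form_def)
  then have "(\<Sum>j\<in>UNIV. \<eta> $ j) = (\<Sum>j\<in>UNIV. \<theta> $ j)"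
    using \<eta>(1) \<theta>(1) unfolding homogeneous_def by blast
  then show "\<alpha> $ 1 + \<alpha> $ 2 = \<beta> $ 1 + \<beta> $ 2"
    using \<eta>(2,3) \<theta>(2,3) by (simp add: sum_2)
qed

section \<open>Brauer solutions for rational coefficients and the resulting functional\<close>

lemma rat_as_nat_quotient:
  fixes \<rho> :: rat
  obtains m k :: nat where "k > 0" "\<rho> = of_nat m / of_nat k" | m k :: nat where "k > 0" "\<rho> = - (of_nat m / of_nat k)"
proof -
  obtain a b where ab: "\<rho> = Fract a b" "b > 0" by (metis Rat_cases)
  show thesis
  proof (cases "a \<ge> 0")
    case True
    with ab show ?thesis by (intro that(1)[of "nat b" "nat a"]) (auto simp: Fract_of_int_quotient)
  next
    case False
    with ab show ?thesis by (intro that(2)[of "nat b" "nat (- a)"]) (auto simp: Fract_of_int_quotient)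
  qed
qed

lemma brauer_rat:
  fixes c :: "nat \<Rightarrow> 'a" and \<rho> :: rat
  assumes "finite (c ` {0<..})"
  obtains x y z :: nat where "x > N" "y > N" "z > N" "c y = c x" "c z = c x"
    "real y = real x + real_of_rat \<rho> * real z"
proof -
  have *: "\<exists>x w. x > N \<and> w > N \<and> c (x + m * w) = c x \<and> c (k * w) = c x" if k: "k > 0" for m k
  proof -
    \<comment> \<open>Restricting the colouring to multiples of \<open>Suc N\<close> pushes all
      entries of a solution above \<open>N\<close>.\<close>
    define c' where "c' = (\<lambda>n. c (Suc N * n))"
    have "c' ` {0<..} \<subseteq> c ` {0<..}" by (auto simp: c'_def)
    then have "finite (c' ` {0<..})" using assms by (rule finite_subset)
    then obtain x w where "x > 0" "w > 0" "c' (x + m * w) = c' x" "c' (k * w) = c' x"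
      by (rule brauer[OF k])
    then have xw: "x > 0" "w > 0" "c (Suc N * (x + m * w)) = c (Suc N * x)"
      "c (Suc N * (k * w)) = c (Suc N * x)"
      unfolding c'_def by blast+
    have "Suc N * i > N" if "i > 0" for i using that by (cases i) auto
    moreover have "c (Suc N * x + m * (Suc N * w)) = c (Suc N * x)" "c (k * (Suc N * w)) = c (Suc N * x)"
      using xw(3,4) by (simp_all only: distrib_left mult.left_commute)
    ultimately show ?thesis using xw(1,2)
      by (intro exI[of _ "Suc N * x"] exI[of _ "Suc N * w"] conjI)
  qed
  show thesis
  proof (cases \<rho> rule: rat_as_nat_quotient)
    case (1 m k)
    from *[OF 1(1), of m] obtain x w where xw: "x > N" "w > N" "c (x + m * w) = c x" "c (k * w) = c x" by blast
    have "k * w > N" using 1(1) xw(2) by (cases k) auto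
    with 1 xw show ?thesis
      by (intro that[of x "x + m * w" "k * w"]) (simp_all add: of_rat_divide)
  next
    case (2 m k)
    from *[OF 2(1), of m] obtain x w where xw: "x > N" "w > N" "c (x + m * w) = c x" "c (k * w) = c x" by blast
    have "k * w > N" using 2(1) xw(2) by (cases k) auto
    \<comment> \<open>For negative \<open>\<rho>\<close> the two ends of the difference
      \<open>m * w\<close> change places.\<close>
    with 2 xw show ?thesis
      by (intro that[of "x + m * w" x "k * w"]) (simp_all add: of_rat_divide of_rat_minus)
  qed
qed

text \<open>A step along \<open>(1, -1, \<rho>)\<close> changes the weight of an exponent by a
  multiple of \<open>x - y + \<rho> * z\<close>. So Brauer solutions give all monomials equal
  weight, and a single block suffices.\<close>

lemma admits_crf_if_rado_form:
  assumes "\<not> homogeneous P" and bij: "bij \<sigma>" and form: "rado_form (permute_vars \<sigma> P) r a \<rho> H"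
  shows "admits_complete_rado_functional P"
proof -
  define S where "S = (\<lambda>c (P :: (3, int) mpoly). {t. monochromatic c t \<and>
    (\<forall>\<alpha>\<in>Poly_Mapping.keys P. \<forall>\<beta>\<in>Poly_Mapping.keys P. dotp \<alpha> t = dotp \<beta> t)})"
  have inf: "infinite (S c (permute_vars \<sigma> P))" if c: "finite_colouring c" for c
  proof
    assume "finite (S c (permute_vars \<sigma> P))"
    \<comment> \<open>Finitely many such \<open>t\<close> would have bounded first entries, whereas
      Brauer solutions exist beyond any bound.\<close>
    then have "finite ((\<lambda>t. t $ 1) ` S c (permute_vars \<sigma> P))" by blast
    then obtain N where N: "\<And>t. t \<in> S c (permute_vars \<sigma> P) \<Longrightarrow> t $ 1 \<le> N"
      by (metis finite_nat_set_iff_bounded_le imageI)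
    obtain x y z :: nat where xyz: "x > N" "y > N" "z > N" "c y = c x" "c z = c x"
      "real y = real x + real_of_rat \<rho> * real z"
      by (rule brauer_rat[of c N \<rho>]) (use c in \<open>auto simp: finite_colouring_def\<close>)
    have "vector [x, y, z] \<in> S c (permute_vars \<sigma> P)"
      unfolding S_def
    proof (intro CollectI conjI ballI)
      show "monochromatic c (vector [x, y, z] :: nat ^ 3)"
        using xyz by (simp add: monochromatic_def forall_3)
      fix \<alpha> \<beta> assume keys: "\<alpha> \<in> Poly_Mapping.keys (permute_vars \<sigma> P)" "\<beta> \<in> Poly_Mapping.keys (permute_vars \<sigma> P)"
      note line = rado_form_line[OF form keys]
      have 2: "real (\<alpha> $ 2) = real (\<beta> $ 2) - (real (\<alpha> $ 1) - real (\<beta> $ 1))"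
        using line(1) by linarith
      have 3: "real (\<alpha> $ 3) = real (\<beta> $ 3) + real_of_rat \<rho> * (real (\<alpha> $ 1) - real (\<beta> $ 1))"
        using line(2) by linarith
      have "real (dotp \<alpha> (vector [x, y, z])) = real (dotp \<beta> (vector [x, y, z]))"
        by (simp add: dotp_def sum_3 2 3 xyz(6) algebra_simps)
      then show "dotp \<alpha> (vector [x, y, z]) = dotp \<beta> (vector [x, y, z])" by linarith
    qed
    then show False using N xyz(1) by fastforce
  qed
  have infS: "infinite (S c P)" if "finite_colouring c" for c
  proof
    assume "finite (S c P)"
    define g where "g = (\<lambda>t :: nat ^ 3. \<chi> j. t $ \<sigma> j)"
    have dotp_g: "dotp (g \<alpha>) (g t) = dotp \<alpha> t" for \<alpha> t
      using sum.reindex_bij_betw[OF bij, of "\<lambda>j. \<alpha> $ j * t $ j"] by (simp add: g_def dotp_def)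
    have mono_g: "monochromatic c (g t) \<longleftrightarrow> monochromatic c t" for t
      unfolding g_def by (rule monochromatic_permute[OF bij])
    have keys_g: "Poly_Mapping.keys P = g ` Poly_Mapping.keys (permute_vars \<sigma> P)"
      using bij_betw_keys_permute_vars[OF bij, of P] by (simp add: bij_betw_def g_def)
    have "g ` S c (permute_vars \<sigma> P) \<subseteq> S c P"
    proof (rule image_subsetI)
      fix t assume "t \<in> S c (permute_vars \<sigma> P)"
      then show "g t \<in> S c P"
        unfolding S_def keys_g mem_Collect_eq ball_simps dotp_g mono_g .
    qed
    then have "finite (g ` S c (permute_vars \<sigma> P))" using \<open>finite (S c P)\<close> by (rule finite_subset)
    moreover have "inj g"
    proof (rule injI)
      fix s t assume "g s = g t"
      then have "s $ \<sigma> j = t $ \<sigma> j" for j by (simp add: g_def vec_eq_iff)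
      then show "s = t" using bij_is_surj[OF bij] by (metis surjD vec_eq_iff)
    qed
    ultimately have "finite (S c (permute_vars \<sigma> P))"
      by (meson finite_imageD inj_on_subset subset_UNIV)
    then show False using inf[OF that] by blast
  qed
  have sub: "{t. monochromatic c t \<and> (\<exists>M :: nat \<Rightarrow> int.
      (\<forall>i j. i < j \<and> j \<le> (0::nat) \<longrightarrow> M i > M j) \<and>
      (\<forall>i\<le>0. Poly_Mapping.keys P = {\<alpha> \<in> Poly_Mapping.keys P. int (dotp \<alpha> t) = M i}) \<and>
      (\<forall>i<0. M i - M 0 = int 1))} \<supseteq> S c P" for c
  proof
    fix t assume t: "t \<in> S c P"
    obtain \<alpha> where "\<alpha> \<in> Poly_Mapping.keys P" using assms(1) unfolding homogeneous_def by blast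
    have "dotp \<beta> t = dotp \<alpha> t" if "\<beta> \<in> Poly_Mapping.keys P" for \<beta>
      using t that \<open>\<alpha> \<in> _\<close> unfolding S_def by blast
    then have "int (dotp \<beta> t) = int (dotp \<alpha> t)" if "\<beta> \<in> Poly_Mapping.keys P" for \<beta>
      using that by (simp only: of_nat_eq_iff)
    then have eq: "Poly_Mapping.keys P = {\<beta> \<in> Poly_Mapping.keys P. int (dotp \<beta> t) = int (dotp \<alpha> t)}"
      by blast
    show "t \<in> {t. monochromatic c t \<and> (\<exists>M :: nat \<Rightarrow> int.
      (\<forall>i j. i < j \<and> j \<le> (0::nat) \<longrightarrow> M i > M j) \<and>
      (\<forall>i\<le>0. Poly_Mapping.keys P = {\<alpha> \<in> Poly_Mapping.keys P. int (dotp \<alpha> t) = M i}) \<and>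
      (\<forall>i<0. M i - M 0 = int 1))}"
    proof (rule CollectI, rule conjI)
      show "monochromatic c t" using t by (simp add: S_def)
    qed (rule exI[of _ "\<lambda>_. int (dotp \<alpha> t)"], intro conjI allI impI eq, simp_all)
  qed
  have inf': "infinite {t. monochromatic c t \<and> (\<exists>M :: nat \<Rightarrow> int.
      (\<forall>i j. i < j \<and> j \<le> (0::nat) \<longrightarrow> M i > M j) \<and>
      (\<forall>i\<le>0. Poly_Mapping.keys P = {\<alpha> \<in> Poly_Mapping.keys P. int (dotp \<alpha> t) = M i}) \<and>
      (\<forall>i<0. M i - M 0 = int 1))}" if "finite_colouring c" for c
    by (rule infinite_super[OF sub infS[OF that]])
  have "complete_rado_functional P 0 (\<lambda>_. Poly_Mapping.keys P) (\<lambda>_. 1)"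
    unfolding complete_rado_functional_def
  proof (intro conjI)
    show "\<forall>i\<le>0::nat. Poly_Mapping.keys P \<noteq> {}"
      using assms(1) unfolding homogeneous_def by blast
    show "\<forall>c. finite_colouring c \<longrightarrow> infinite {t. monochromatic c t \<and> (\<exists>M :: nat \<Rightarrow> int.
        (\<forall>i j. i < j \<and> j \<le> (0::nat) \<longrightarrow> M i > M j) \<and>
        (\<forall>i\<le>0. Poly_Mapping.keys P = {\<alpha> \<in> Poly_Mapping.keys P. int (dotp \<alpha> t) = M i}) \<and>
        (\<forall>i<0. M i - M 0 = int 1))}"
      by (intro allI impI inf')
  qed simp_all
  then show ?thesis unfolding admits_complete_rado_functional_def by blast
qed

section \<open>Partition regularity and the linear factors\<close>

text \<open>\<open>eval_mpoly\<close> covers integer coefficients only, but the linear factors of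
  \<open>H\<close> are complex. The lemmas below make evaluation compatible with sums and
  products.\<close>

definition eval_poly_mapping :: "('n::finite, 'a::comm_ring_1) mpoly \<Rightarrow> 'a ^ 'n \<Rightarrow> 'a" where
  "eval_poly_mapping p x =
     (\<Sum>\<alpha>\<in>Poly_Mapping.keys p. Poly_Mapping.lookup p \<alpha> * (\<Prod>j\<in>UNIV. (x $ j) ^ (\<alpha> $ j)))"

lemma eval_poly_mapping_superset:
  assumes "finite S" "Poly_Mapping.keys p \<subseteq> S"
  shows "eval_poly_mapping p x = (\<Sum>\<alpha>\<in>S. Poly_Mapping.lookup p \<alpha> * (\<Prod>j\<in>UNIV. (x $ j) ^ (\<alpha> $ j)))"
  unfolding eval_poly_mapping_def
  by (rule sum.mono_neutral_left[OF assms]) (simp add: in_keys_iff)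

lemma eval_poly_mapping_add: "eval_poly_mapping (p + q) x = eval_poly_mapping p x + eval_poly_mapping q x"
proof -
  have *: "finite (Poly_Mapping.keys p \<union> Poly_Mapping.keys q)" by simp
  show ?thesis
    unfolding eval_poly_mapping_superset[OF * keys_add] eval_poly_mapping_superset[OF * Un_upper1]
      eval_poly_mapping_superset[OF * Un_upper2]
    by (simp add: lookup_add distrib_right sum.distrib)
qed

lemma eval_poly_mapping_single:
  "eval_poly_mapping (Poly_Mapping.single \<alpha> a) x = a * (\<Prod>j\<in>UNIV. (x $ j) ^ (\<alpha> $ j))"
  by (subst eval_poly_mapping_superset[of "{\<alpha>}"]) auto

lemma eval_poly_mapping_sum: "eval_poly_mapping (sum f S) x = (\<Sum>i\<in>S. eval_poly_mapping (f i) x)"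
  by (induction S rule: infinite_finite_induct)
    (simp_all add: eval_poly_mapping_add, simp_all add: eval_poly_mapping_def)

lemma poly_mapping_eq_sum_single:
  "p = (\<Sum>\<alpha>\<in>Poly_Mapping.keys p. Poly_Mapping.single \<alpha> (Poly_Mapping.lookup p \<alpha>))"
proof (rule poly_mapping_eqI)
  fix \<beta>
  have "Poly_Mapping.lookup p \<beta> = (\<Sum>\<alpha>\<in>Poly_Mapping.keys p. if \<alpha> = \<beta> then Poly_Mapping.lookup p \<alpha> else 0)"
    by (simp add: in_keys_iff)
  then show "Poly_Mapping.lookup p \<beta> =
      Poly_Mapping.lookup (\<Sum>\<alpha>\<in>Poly_Mapping.keys p. Poly_Mapping.single \<alpha> (Poly_Mapping.lookup p \<alpha>)) \<beta>"
    by (simp only: lookup_sum lookup_single when_def)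
qed

lemma eval_poly_mapping_mult: "eval_poly_mapping (p * q) x = eval_poly_mapping p x * eval_poly_mapping q x"
proof -
  have "p * q = (\<Sum>\<alpha>\<in>Poly_Mapping.keys p. \<Sum>\<beta>\<in>Poly_Mapping.keys q.
      Poly_Mapping.single (\<alpha> + \<beta>) (Poly_Mapping.lookup p \<alpha> * Poly_Mapping.lookup q \<beta>))"
    by (subst poly_mapping_eq_sum_single[of p], subst poly_mapping_eq_sum_single[of q])
      (simp add: sum_product mult_single)
  then show ?thesis
    by (simp add: eval_poly_mapping_sum eval_poly_mapping_single)
      (simp add: eval_poly_mapping_def sum_product power_add prod.distrib mult_ac)
qed

lemma eval_poly_mapping_one: "eval_poly_mapping 1 x = 1"
  using eval_poly_mapping_single[of 0 1 x] by simp

lemma eval_poly_mapping_prod: "eval_poly_mapping (prod f S) x = (\<Prod>i\<in>S. eval_poly_mapping (f i) x)"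
  by (induction S rule: infinite_finite_induct) (simp_all add: eval_poly_mapping_mult eval_poly_mapping_one)

lemma eval_linear_form: "eval_poly_mapping (linear_form a b) x = a * x $ 1 - b * x $ 2"
proof -
  have "linear_form a b = Poly_Mapping.single (axis 1 1) a + Poly_Mapping.single (axis 2 1) (- b)"
    by (simp add: linear_form_def single_uminus)
  then show ?thesis
    by (simp add: eval_poly_mapping_add eval_poly_mapping_single prod_UNIV_2 axis_def)
qed

section \<open>Zeros of \<open>P\<close> in terms of the linear factors of \<open>H\<close>\<close>

lemma keys_map_of_int:
  "Poly_Mapping.keys (Poly_Mapping.map (of_int :: int \<Rightarrow> 'a::ring_char_0) p) = Poly_Mapping.keys p"
  by (auto simp: in_keys_iff map.rep_eq when_def)

lemma eval_poly_mapping_of_int: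
  "eval_poly_mapping (Poly_Mapping.map of_int p) (\<chi> j. complex_of_real (x $ j)) = complex_of_real (eval_mpoly p x)"
  unfolding eval_poly_mapping_def eval_mpoly_def keys_map_of_int
  by (simp add: map.rep_eq when_def in_keys_iff)

lemma eval_mpoly_of_int: "eval_mpoly p (\<chi> j. real_of_int (x $ j)) = real_of_int (eval_mpoly p x)"
  by (simp add: eval_mpoly_def)

text \<open>The factor \<open>z powr (r - a * \<rho>)\<close> is positive, and a product of complex
  numbers vanishes only if a factor does. Avoiding quotients covers factors with
  \<open>A i = 0\<close> as well.\<close>

lemma rado_form_zero_iff:
  fixes t :: "nat ^ 3" and A B :: "nat \<Rightarrow> complex"
  assumes form: "rado_form P r a \<rho> H" and H: "Poly_Mapping.map of_int H = (\<Prod>i = 1..k. linear_form (A i) (B i))"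
    and pos: "\<And>j. t $ j > 0"
  shows "eval_mpoly P (\<chi> j. int (t $ j)) = 0 \<longleftrightarrow>
    (\<exists>i\<in>{1..k}. A i * of_real (real (t $ 1) * real (t $ 3) powr real_of_rat \<rho>) = B i * of_nat (t $ 2))"
proof -
  define u where "u = real (t $ 1) * real (t $ 3) powr real_of_rat \<rho>"
  have vec: "(\<chi> j. real (t $ j)) = vector [real (t $ 1), real (t $ 2), real (t $ 3)]"
    by (simp add: vec_eq_iff forall_3)
  have "eval_mpoly P (\<chi> j. int (t $ j)) = 0 \<longleftrightarrow> eval_mpoly P (\<chi> j. real (t $ j)) = 0"
    using eval_mpoly_of_int[of P "\<chi> j. int (t $ j)"] by simp
  also have "\<dots> \<longleftrightarrow> eval_mpoly H (vector [u, real (t $ 2)]) = 0"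
    using form pos[of 1] pos[of 2] pos[of 3] unfolding rado_form_def vec u_def by simp
  also have "\<dots> \<longleftrightarrow> eval_poly_mapping (Poly_Mapping.map of_int H)
      (\<chi> j. complex_of_real (vector [u, real (t $ 2)] $ j)) = 0"
    unfolding eval_poly_mapping_of_int by simp
  also have "\<dots> \<longleftrightarrow> (\<exists>i\<in>{1..k}. A i * of_real u = B i * of_nat (t $ 2))"
    unfolding H by (simp add: eval_poly_mapping_prod eval_linear_form)
  finally show ?thesis unfolding u_def .
qed

text \<open>For \<open>\<rho> = 0\<close> the third exponent is constant on the support, and so is
  the sum of the first two.\<close>

lemma rado_form_rho_nonzero:
  assumes "rado_form P r a \<rho> H" "\<not> homogeneous P"
  shows "\<rho> \<noteq> 0"
proof
  assume "\<rho> = 0"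
  then have "(\<Sum>j\<in>UNIV. \<alpha> $ j) = (\<Sum>j\<in>UNIV. \<beta> $ j)"
    if "\<alpha> \<in> Poly_Mapping.keys P" "\<beta> \<in> Poly_Mapping.keys P" for \<alpha> \<beta>
    using rado_form_line[OF assms(1) that] by (simp add: sum_3)
  then show False using assms(2) unfolding homogeneous_def by blast
qed

text \<open>A zero factor would make \<open>H\<close> zero, but each monomial of the nonzero
  \<open>P\<close> comes from one of \<open>H\<close>.\<close>

lemma rado_form_factor_nonzero:
  fixes A B :: "nat \<Rightarrow> complex"
  assumes "rado_form P r a \<rho> H" "\<not> homogeneous P"
    and "Poly_Mapping.map of_int H = (\<Prod>i = 1..k. linear_form (A i) (B i))" "i \<in> {1..k}"
  shows "A i \<noteq> 0 \<or> B i \<noteq> 0"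
proof (rule ccontr)
  assume "\<not> (A i \<noteq> 0 \<or> B i \<noteq> 0)"
  then have "linear_form (A i) (B i) = 0" by (simp add: linear_form_def)
  then have "Poly_Mapping.map (of_int :: int \<Rightarrow> complex) H = 0"
    unfolding assms(3) using assms(4) by (intro prod_zero) auto
  then have "Poly_Mapping.keys H = {}" using keys_map_of_int[of H, where 'a = complex] by simp
  moreover obtain \<alpha> where "\<alpha> \<in> Poly_Mapping.keys P" using assms(2) unfolding homogeneous_def by blast
  ultimately show False using rado_form_keys[OF assms(1)] by blast
qed

lemma partition_regular_if_rho_power_in_N:
  fixes A B :: "nat \<Rightarrow> complex"
  assumes form: "rado_form P r a \<rho> H" and H: "Poly_Mapping.map of_int H = (\<Prod>i = 1..k. linear_form (A i) (B i))"
    and i: "i \<in> {1..k}" "A i \<noteq> 0" "rho_power_in_N \<rho> (B i / A i)"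
  shows "partition_regular P"
  unfolding partition_regular_def
proof (intro allI impI)
  fix c assume c: "finite_colouring c"
  obtain l :: nat where l: "l > 0" "B i / A i = complex_of_real (real l powr real_of_rat \<rho>)"
    using i(3) unfolding rho_power_in_N_def by blast
  then have B: "B i = A i * complex_of_real (real l powr real_of_rat \<rho>)"
    using i(2) by (simp add: field_simps)
  \<comment> \<open>Colouring exponents turns the additive Brauer equation into a multiplicative
    one; the scaling by \<open>l\<close> supplies the factor \<open>l powr \<rho>\<close> through
    the third entry and cancels between the first two.\<close>
  define c' where "c' = (\<lambda>n. c (l * 2 ^ n))"
  have "c' ` {0<..} \<subseteq> c ` {0<..}" using l(1) by (auto simp: c'_def)
  then have "finite (c' ` {0<..})" using c unfolding finite_colouring_def by (rule finite_subset)
  then obtain x y z :: nat where "c' y = c' x" "c' z = c' x" and xyz: "real y = real x + real_of_rat \<rho> * real z"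
    by (rule brauer_rat[where \<rho> = \<rho> and N = 0])
  define t :: "nat ^ 3" where "t = vector [l * 2 ^ x, l * 2 ^ y, l * 2 ^ z]"
  have "monochromatic c t"
    using \<open>c' y = c' x\<close> \<open>c' z = c' x\<close> l(1) by (simp add: monochromatic_def forall_3 t_def c'_def)
  moreover have "real (t $ 1) * real (t $ 3) powr real_of_rat \<rho> = real l powr real_of_rat \<rho> * real (t $ 2)"
  proof -
    have "2 ^ x * (2 ^ z) powr real_of_rat \<rho> = (2 :: real) ^ y"
      using xyz by (simp add: powr_powr mult.commute flip: powr_realpow powr_add)
    then have "real l * 2 ^ x * (real l powr real_of_rat \<rho> * (2 ^ z) powr real_of_rat \<rho>)
        = real l powr real_of_rat \<rho> * (real l * 2 ^ y)"
      by (simp add: mult_ac)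
    then show ?thesis by (simp add: t_def powr_mult)
  qed
  then have "A i * of_real (real (t $ 1) * real (t $ 3) powr real_of_rat \<rho>) = B i * of_nat (t $ 2)"
    unfolding B by simp
  then have "eval_mpoly P (\<chi> j. int (t $ j)) = 0"
    using i(1) \<open>monochromatic c t\<close> unfolding monochromatic_def
    by (subst rado_form_zero_iff[OF form H]) auto
  ultimately show "\<exists>t. monochromatic c t \<and> eval_mpoly P (\<chi> j. int (t $ j)) = 0" by blast
qed

section \<open>Valuations modulo the numerator and rational powers\<close>

lemma dvd_multiplicity_if_congruent:
  fixes x y z x0 y0 z0 m k p :: nat
  assumes p: "prime p" and pos: "x > 0" "y > 0" "z > 0" "x0 > 0" "y0 > 0" "z0 > 0" "m > 0"
    and eq: "x ^ k * z ^ m * y0 ^ k = x0 ^ k * z0 ^ m * y ^ k"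
    and cong: "multiplicity p x mod m = multiplicity p y mod m"
  shows "m dvd multiplicity p (x0 ^ k * y0 ^ (k * (m - 1)))"
proof -
  have pe: "prime_elem p" using p by simp
  note mult = prime_elem_multiplicity_mult_distrib[OF pe] prime_elem_multiplicity_power_distrib[OF pe]
  have "multiplicity p (x ^ k * z ^ m * y0 ^ k) = multiplicity p (x0 ^ k * z0 ^ m * y ^ k)" by (simp only: eq)
  then have "k * multiplicity p x + m * multiplicity p z + k * multiplicity p y0 =
      k * multiplicity p x0 + m * multiplicity p z0 + k * multiplicity p y"
    using pos by (simp add: mult)
  \<comment> \<open>Integers are used since differences of valuations may be negative.\<close>
  from arg_cong[OF this, of int]
  have eq': "int k * (int (multiplicity p x0) - int (multiplicity p y0)) =
      int k * (int (multiplicity p x) - int (multiplicity p y)) +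
      int m * (int (multiplicity p z) - int (multiplicity p z0))"
    by (simp add: algebra_simps)
  have "int m dvd int (multiplicity p x) - int (multiplicity p y)"
    using cong by (metis mod_eq_dvd_iff of_nat_mod)
  then have "int m dvd int k * (int (multiplicity p x0) - int (multiplicity p y0))"
    unfolding eq' by simp
  \<comment> \<open>A multiple of \<open>m\<close> is added to replace \<open>y0 ^ (-k)\<close> by
    the natural number \<open>y0 ^ (k * (m - 1))\<close>.\<close>
  then have "int m dvd int k * (int (multiplicity p x0) - int (multiplicity p y0)) + int m * (int k * int (multiplicity p y0))"
    by simp
  also have "\<dots> = int (multiplicity p (x0 ^ k * y0 ^ (k * (m - 1))))"
    using pos by (cases m) (simp_all add: mult algebra_simps)
  finally show ?thesis by simp
qed

text \<open>Congruent valuations at every prime, with a representation of \<open>w\<close> that may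
  depend on the prime, make \<open>(x0 / y0) ^ k\<close> an \<open>m\<close>-th power of a rational,
  hence also \<open>w ^ k\<close>.\<close>

lemma rational_power_if_congruent:
  fixes w :: real and m k x0 y0 z0 :: nat
  assumes pos: "m > 0" "k > 0" "x0 > 0" "y0 > 0" "z0 > 0" and w: "w = x0 * z0 powr (m / k) / y0"
    and cong: "\<And>p. prime p \<Longrightarrow> \<exists>(x::nat) (y::nat) (z::nat). x > 0 \<and> y > 0 \<and> z > 0 \<and>
      w = x * z powr (m / k) / y \<and> multiplicity p x mod m = multiplicity p y mod m"
  shows "\<exists>q :: rat. q > 0 \<and> w = real_of_rat q powr (m / k)"
proof -
  have pow_k: "(z powr (m / k)) ^ k = real z ^ m" if "z > 0" for z :: nat
    using that pos by (simp add: powr_powr flip: powr_realpow)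
  have w_pow: "w ^ k = x ^ k * z ^ m / y ^ k" if "w = x * z powr (m / k) / y" "z > 0" for x y z :: nat
    using that by (simp add: power_divide power_mult_distrib pow_k)
  have "is_nth_power m (x0 ^ k * y0 ^ (k * (m - 1)))"
    unfolding is_nth_power_conv_multiplicity_nat[OF pos(1)]
  proof (intro allI impI)
    fix p :: nat assume p: "prime p"
    obtain x y z :: nat where xyz: "x > 0" "y > 0" "z > 0" "w = x * z powr (m / k) / y"
      "multiplicity p x mod m = multiplicity p y mod m"
      using cong[OF p] by blast
    have "real x ^ k * real z ^ m / real y ^ k = real x0 ^ k * real z0 ^ m / real y0 ^ k"
      using w_pow[OF xyz(4,3)] w_pow[OF w pos(5)] by simp
    then have "real x ^ k * real z ^ m * real y0 ^ k = real x0 ^ k * real z0 ^ m * real y ^ k"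
      using xyz pos by (simp add: field_simps)
    then have "x ^ k * z ^ m * y0 ^ k = x0 ^ k * z0 ^ m * y ^ k"
      by (simp only: of_nat_eq_iff flip: of_nat_mult of_nat_power)
    then show "m dvd multiplicity p (x0 ^ k * y0 ^ (k * (m - 1)))"
      by (rule dvd_multiplicity_if_congruent[OF p xyz(1-3) pos(3-5,1) _ xyz(5)])
  qed
  then obtain n where n: "x0 ^ k * y0 ^ (k * (m - 1)) = n ^ m" by (rule is_nth_powerE)
  have "n > 0" using n pos by (cases n) (auto simp: power_0_left)
  \<comment> \<open>From \<open>(x0 / y0) ^ k = (n / y0 ^ k) ^ m\<close> one reads off
    \<open>w ^ k = q ^ m\<close>.\<close>
  define q :: rat where "q = of_nat n * of_nat z0 / of_nat y0 ^ k"
  have q: "q > 0" using \<open>n > 0\<close> pos by (simp add: q_def)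
  have q_real: "real_of_rat q = real n * real z0 / real y0 ^ k"
    by (simp add: q_def of_rat_divide of_rat_mult of_rat_power)
  have "w > 0" using pos by (simp add: w)
  have nm: "real n ^ m = real x0 ^ k * real y0 ^ (k * (m - 1))"
    using n by (metis of_nat_mult of_nat_power)
  have "(real y0 ^ k) ^ m = real y0 ^ (k * (m - 1)) * real y0 ^ k"
  proof -
    have "k * m = k * (m - 1) + k" using pos(1) by (cases m) auto
    then show ?thesis by (simp add: power_add flip: power_mult)
  qed
  then have "w ^ k = real_of_rat q ^ m"
    unfolding w_pow[OF w pos(5)] q_real using pos nm
    by (simp add: power_divide power_mult_distrib)
  then have "w powr real k = real_of_rat q powr real m"
    using q \<open>w > 0\<close> by (simp add: powr_realpow)
  then have "(w powr real k) powr (1 / k) = (real_of_rat q powr real m) powr (1 / k)" by simp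
  then have "w = real_of_rat q powr (m / k)" using \<open>w > 0\<close> pos by (simp add: powr_powr)
  then show ?thesis using q by blast
qed

text \<open>Contrapositive of the preceding lemma. The modulus depends on \<open>\<rho>\<close>
  alone, being the absolute numerator of a fraction for it, so finitely many \<open>w\<close> can be
  handled by one colouring; only \<open>p\<close> depends on \<open>w\<close>.\<close>

lemma valuation_obstruction:
  fixes \<rho> :: rat
  assumes "\<rho> \<noteq> 0"
  shows "\<exists>m>0. \<forall>w :: real. \<not> (\<exists>q :: rat. q > 0 \<and> w = real_of_rat q powr real_of_rat \<rho>) \<longrightarrow>
      (\<exists>p. \<forall>(x::nat) (y::nat) (z::nat). x > 0 \<longrightarrow> y > 0 \<longrightarrow> z > 0 \<longrightarrow> w = x * z powr real_of_rat \<rho> / y \<longrightarrow>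
        multiplicity p x mod m \<noteq> multiplicity p y mod m)"
proof (cases \<rho> rule: rat_as_nat_quotient)
  case (1 m k)
  have "m > 0" using assms 1 by (cases m) auto
  have \<rho>: "real_of_rat \<rho> = m / k" using 1 by (simp add: of_rat_divide)
  show ?thesis
  proof (rule exI[of _ m], intro conjI allI impI \<open>m > 0\<close>, rule ccontr)
    fix w :: real
    assume non: "\<not> (\<exists>q :: rat. q > 0 \<and> w = real_of_rat q powr real_of_rat \<rho>)"
      and neg: "\<not> (\<exists>p. \<forall>(x::nat) (y::nat) (z::nat). x > 0 \<longrightarrow> y > 0 \<longrightarrow> z > 0 \<longrightarrow> w = x * z powr real_of_rat \<rho> / y \<longrightarrow>
        multiplicity p x mod m \<noteq> multiplicity p y mod m)"
    from neg have *: "\<exists>(x::nat) (y::nat) (z::nat). x > 0 \<and> y > 0 \<and> z > 0 \<and>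
      w = x * z powr (m / k) / y \<and> multiplicity p x mod m = multiplicity p y mod m" for p
      by (simp only: not_ex not_all not_imp not_not \<rho>)
    then obtain x0 y0 z0 :: nat where "x0 > 0" "y0 > 0" "z0 > 0" "w = x0 * z0 powr (m / k) / y0"
      by blast
    from rational_power_if_congruent[OF \<open>m > 0\<close> 1(1) this *] show False
      using non unfolding \<rho> by blast
  qed
next
  case (2 m k)
  have "m > 0" using assms 2 by (cases m) auto
  have \<rho>: "real_of_rat \<rho> = - (m / k)" using 2 by (simp add: of_rat_divide of_rat_minus)
  show ?thesis
  proof (rule exI[of _ m], intro conjI allI impI \<open>m > 0\<close>, rule ccontr)
    fix w :: real
    assume non: "\<not> (\<exists>q :: rat. q > 0 \<and> w = real_of_rat q powr real_of_rat \<rho>)"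
      and neg: "\<not> (\<exists>p. \<forall>(x::nat) (y::nat) (z::nat). x > 0 \<longrightarrow> y > 0 \<longrightarrow> z > 0 \<longrightarrow> w = x * z powr real_of_rat \<rho> / y \<longrightarrow>
        multiplicity p x mod m \<noteq> multiplicity p y mod m)"
    from neg have *: "\<exists>(x::nat) (y::nat) (z::nat). x > 0 \<and> y > 0 \<and> z > 0 \<and>
      w = x * z powr (- (m / k)) / y \<and> multiplicity p x mod m = multiplicity p y mod m" for p
      by (simp only: not_ex not_all not_imp not_not \<rho>)
    \<comment> \<open>Passing to \<open>1 / w\<close> makes the exponent positive and swaps
      \<open>x\<close> with \<open>y\<close>, which the congruence allows.\<close>
    have swap: "\<exists>(x::nat) (y::nat) (z::nat). x > 0 \<and> y > 0 \<and> z > 0 \<and>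
      1 / w = x * z powr (m / k) / y \<and> multiplicity p x mod m = multiplicity p y mod m" for p
    proof -
      obtain x y z :: nat where xyz: "x > 0" "y > 0" "z > 0"
        "w = x * z powr (- (m / k)) / y" "multiplicity p x mod m = multiplicity p y mod m"
        using *[of p] by blast
      then have "w > 0" by simp
      with xyz have inv: "1 / w = y * z powr (m / k) / x" by (simp add: powr_minus field_simps)
      show ?thesis
        by (rule exI[of _ y], rule exI[of _ x], rule exI[of _ z]) (use xyz inv in simp)
    qed
    then obtain x0 y0 z0 :: nat where "x0 > 0" "y0 > 0" "z0 > 0" "1 / w = x0 * z0 powr (m / k) / y0"
      by blast
    from rational_power_if_congruent[OF \<open>m > 0\<close> 2(1) this swap]
    obtain q :: rat where "q > 0" and q: "1 / w = real_of_rat q powr (m / k)" by blast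
    have "w = 1 / (1 / w)" by simp
    then have "w = real_of_rat q powr (- (m / k))" unfolding q by (simp only: powr_minus_divide)
    then show False using non \<open>q > 0\<close> unfolding \<rho> by blast
  qed
qed

text \<open>If no quotient were a \<open>\<rho>\<close>-power, colouring by the residues of all
  obstructing valuations would exclude a monochromatic zero: it would represent one of the quotients
  with congruent valuations.\<close>

lemma rho_power_in_Q_if_partition_regular:
  fixes A B :: "nat \<Rightarrow> complex"
  assumes form: "rado_form P r a \<rho> H" and "\<not> homogeneous P"
    and H: "Poly_Mapping.map of_int H = (\<Prod>i = 1..k. linear_form (A i) (B i))"
    and PR: "partition_regular P"
  shows "\<exists>i\<in>{1..k}. A i \<noteq> 0 \<and> rho_power_in_Q \<rho> (B i / A i)"
proof (rule ccontr)
  assume none: "\<not> ?thesis"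
  \<comment> \<open>Only real quotients matter, because at a zero the quotient equals the real
    number \<open>u / y\<close>.\<close>
  define W where "W = {w :: real. \<exists>i\<in>{1..k}. A i \<noteq> 0 \<and> complex_of_real w = B i / A i}"
  have "W \<subseteq> (\<lambda>i. Re (B i / A i)) ` {1..k}"
  proof
    fix w assume "w \<in> W"
    then obtain i where "i \<in> {1..k}" "complex_of_real w = B i / A i" by (auto simp: W_def)
    moreover from this have "w = Re (B i / A i)" by (metis Re_complex_of_real)
    ultimately show "w \<in> (\<lambda>i. Re (B i / A i)) ` {1..k}" by (intro image_eqI)
  qed
  then have finW: "finite W" by (rule finite_subset) simp
  obtain m :: nat where m: "m > 0"
    "\<forall>w :: real. \<not> (\<exists>q :: rat. q > 0 \<and> w = real_of_rat q powr real_of_rat \<rho>) \<longrightarrow>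
      (\<exists>p. \<forall>(x::nat) (y::nat) (z::nat). x > 0 \<longrightarrow> y > 0 \<longrightarrow> z > 0 \<longrightarrow> w = x * z powr real_of_rat \<rho> / y \<longrightarrow>
        multiplicity p x mod m \<noteq> multiplicity p y mod m)"
    using valuation_obstruction[OF rado_form_rho_nonzero[OF form assms(2)]] by blast
  have "\<exists>p. \<forall>(x::nat) (y::nat) (z::nat). x > 0 \<longrightarrow> y > 0 \<longrightarrow> z > 0 \<longrightarrow> w = x * z powr real_of_rat \<rho> / y \<longrightarrow>
        multiplicity p x mod m \<noteq> multiplicity p y mod m" if "w \<in> W" for w
  proof (rule m(2)[rule_format])
    show "\<not> (\<exists>q :: rat. q > 0 \<and> w = real_of_rat q powr real_of_rat \<rho>)"
      using none that unfolding W_def rho_power_in_Q_def by fastforce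
  qed
  then have "\<forall>w\<in>W. \<exists>p. \<forall>(x::nat) (y::nat) (z::nat). x > 0 \<longrightarrow> y > 0 \<longrightarrow> z > 0 \<longrightarrow> w = x * z powr real_of_rat \<rho> / y \<longrightarrow>
        multiplicity p x mod m \<noteq> multiplicity p y mod m" by blast
  from bchoice[OF this] obtain p where p: "\<forall>w\<in>W. \<forall>(x::nat) (y::nat) (z::nat). x > 0 \<longrightarrow> y > 0 \<longrightarrow> z > 0 \<longrightarrow>
      w = x * z powr real_of_rat \<rho> / y \<longrightarrow> multiplicity (p w) x mod m \<noteq> multiplicity (p w) y mod m"
    by blast
  define f where "f = (\<lambda>n :: nat. \<lambda>w\<in>W. multiplicity (p w) n mod m)"
  have f: "range f \<subseteq> (W \<rightarrow>\<^sub>E {..<m})" using m(1) by (auto simp: f_def)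
  then have "finite (range f)" by (rule finite_subset) (intro finite_PiE finW finite_lessThan)
  \<comment> \<open>Colours must be natural numbers, so the tuples of residues are encoded
    injectively.\<close>
  then obtain g :: "(real \<Rightarrow> nat) \<Rightarrow> nat" where g: "inj_on g (range f)"
    using finite_imp_inj_to_nat_seg[OF \<open>finite (range f)\<close>] by auto
  have "finite_colouring (g \<circ> f)"
    unfolding finite_colouring_def image_comp[symmetric]
    by (intro finite_imageI finite_subset[OF _ \<open>finite (range f)\<close>]) blast
  then obtain t :: "nat ^ 3" where t: "monochromatic (g \<circ> f) t" "eval_mpoly P (\<chi> j. int (t $ j)) = 0"
    using PR unfolding partition_regular_def by blast
  then have pos: "t $ j > 0" for j by (simp add: monochromatic_def)
  define u where "u = real (t $ 1) * real (t $ 3) powr real_of_rat \<rho>"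
  obtain i where i: "i \<in> {1..k}" "A i * of_real u = B i * of_nat (t $ 2)"
    using t(2) unfolding rado_form_zero_iff[OF form H pos] u_def by blast
  have "A i \<noteq> 0"
  proof
    assume "A i = 0"
    then have "B i = 0" using i(2) pos[of 2] by simp
    then show False using rado_form_factor_nonzero[OF form assms(2) H i(1)] \<open>A i = 0\<close> by simp
  qed
  have "u / t $ 2 \<in> W"
    unfolding W_def
  proof (intro CollectI bexI[OF _ i(1)] conjI)
    show "complex_of_real (u / t $ 2) = B i / A i"
      using i(2) \<open>A i \<noteq> 0\<close> pos[of 2] by (simp add: field_simps)
  qed (rule \<open>A i \<noteq> 0\<close>)
  moreover have "g (f (t $ 1)) = g (f (t $ 2))" using t(1) by (simp add: monochromatic_def)
  then have "f (t $ 1) = f (t $ 2)" using g by (simp add: inj_on_eq_iff)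
  then have "f (t $ 1) (u / t $ 2) = f (t $ 2) (u / t $ 2)" by simp
  ultimately show False using p pos unfolding f_def u_def by simp
qed

text \<open>Inhomogeneity and partition regularity pass between \<open>P\<close> and its permuted
  form, so (1) and (2) reduce to the permuted polynomial.\<close>

theorem theorem4p6:
  fixes P :: "(3, int) mpoly"
  assumes "\<not> homogeneous P"
  shows "(admits_complete_rado_functional P \<longleftrightarrow>
            (\<exists>\<sigma> r a \<rho> H. bij \<sigma> \<and> rado_form (permute_vars \<sigma> P) r a \<rho> H)) \<and>
         (\<forall>\<sigma> r a \<rho> H k. \<forall>A B :: nat \<Rightarrow> complex.
            bij \<sigma> \<and> rado_form (permute_vars \<sigma> P) r a \<rho> H \<and>
            Poly_Mapping.map of_int H = (\<Prod>i = 1..k. linear_form (A i) (B i)) \<longrightarrow>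
              (partition_regular P \<longrightarrow>
                 (\<exists>i\<in>{1..k}. A i \<noteq> 0 \<and> rho_power_in_Q \<rho> (B i / A i))) \<and>
              ((\<exists>i\<in>{1..k}. A i \<noteq> 0 \<and> rho_power_in_N \<rho> (B i / A i)) \<longrightarrow>
                 partition_regular P))"
proof (intro conjI allI impI iffI)
  assume "admits_complete_rado_functional P"
  then show "\<exists>\<sigma> r a \<rho> H. bij \<sigma> \<and> rado_form (permute_vars \<sigma> P) r a \<rho> H"
    using rado_form_if_crf[OF assms] unfolding admits_complete_rado_functional_def by blast
next
  assume "\<exists>\<sigma> r a \<rho> H. bij \<sigma> \<and> rado_form (permute_vars \<sigma> P) r a \<rho> H"
  then show "admits_complete_rado_functional P"
    using admits_crf_if_rado_form[OF assms] by blast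
next
  fix \<sigma> r a \<rho> H k and A B :: "nat \<Rightarrow> complex"
  assume *: "bij \<sigma> \<and> rado_form (permute_vars \<sigma> P) r a \<rho> H \<and>
    Poly_Mapping.map of_int H = (\<Prod>i = 1..k. linear_form (A i) (B i))"
  then have "\<not> homogeneous (permute_vars \<sigma> P)" using homogeneous_permute_vars assms by blast
  moreover assume "partition_regular P"
  then have "partition_regular (permute_vars \<sigma> P)" using * partition_regular_permute_vars by blast
  ultimately show "\<exists>i\<in>{1..k}. A i \<noteq> 0 \<and> rho_power_in_Q \<rho> (B i / A i)"
    using * rho_power_in_Q_if_partition_regular by blast
next
  fix \<sigma> r a \<rho> H k and A B :: "nat \<Rightarrow> complex"
  assume *: "bij \<sigma> \<and> rado_form (permute_vars \<sigma> P) r a \<rho> H \<and>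
    Poly_Mapping.map of_int H = (\<Prod>i = 1..k. linear_form (A i) (B i))"
  assume "\<exists>i\<in>{1..k}. A i \<noteq> 0 \<and> rho_power_in_N \<rho> (B i / A i)"
  then have "partition_regular (permute_vars \<sigma> P)"
    using * partition_regular_if_rho_power_in_N by blast
  then show "partition_regular P" using * partition_regular_permute_vars by blast
qed

end
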